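(* Let $k\ge 1$, let $D\subset\mathbb{R}^n$ be open, let $T>0$, $\varepsilon_0>0$, and let $F_i:\mathbb{R}\times D\to\mathbb{R}^n$ ($i=1,\ldots,k$) and $R:\mathbb{R}\times D\times[-\varepsilon_0,\varepsilon_0]\to\mathbb{R}^n$ be smooth functions that are $T$-periodic in the variable $t$. Consider the differential equation $$x'=\sum_{i=1}^k\varepsilon^iF_i(t,x)+\varepsilon^{k+1}R(t,x,\varepsilon).$$ Let $\mathbf{g}_1,\ldots,\mathbf{g}_k:D\to\mathbb{R}^n$ be its stroboscopic averaged functions and let $\mathbf{f}_1,\ldots,\mathbf{f}_k:D\to\mathbb{R}^n$ be its Melnikov functions (both defined in the context). Then, for all $z\in D$, $$\mathbf{g}_1(z)=\frac1T\,\mathbf{f}_1(z),$$ and, for $i\in\{2,\ldots,k\}$, $$\mathbf{g}_i(z)=\frac1T\left(\mathbf{f}_i(z)-\sum_{j=1}^{i-1}\sum_{m=1}^{j}\frac{1}{j!}\,d^m\mathbf{g}_{i-j}(z)\int_0^T B_{j,m}\big(\tilde y_1,\ldots,\tilde y_{j-m+1}\big)(s,z)\,ds\right),$$ where the functions $\tilde y_i(t,z)$, $i\in\{1,\ldots,k\}$, are polynomial in the variable $t$ and are recursively defined by $$\tilde y_1(t,z)=t\,\mathbf{g}_1(z),$$ $$\tilde y_i(t,z)=i!\,t\,\mathbf{g}_i(z)+\sum_{j=1}^{i-1}\sum_{m=1}^{j}\frac{i!}{j!}\,d^m\mathbf{g}_{i-j}(z)\int_0^t B_{j,m}\big(\tilde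 y_1,\ldots,\tilde y_{j-m+1}\big)(s,z)\,ds,\qquad i\in\{2,\ldots,k\}.$$
   Context: Setting: the differential equation is $x'=\sum_{i=1}^k\varepsilon^iF_i(t,x)+\varepsilon^{k+1}R(t,x,\varepsilon)$, with all data smooth and $T$-periodic in $t$. Partial Bell polynomials: for positive integers $p\ge q$, $$B_{p,q}(x_1,\ldots,x_{p-q+1})=\sum\frac{p!}{b_1!\,b_2!\cdots b_{p-q+1}!}\prod_{j=1}^{p-q+1}\left(\frac{x_j}{j!}\right)^{b_j},$$ where the sum is over all tuples of nonnegative integers $(b_1,\ldots,b_{p-q+1})$ with $b_1+2b_2+\cdots+(p-q+1)b_{p-q+1}=p$ and $b_1+\cdots+b_{p-q+1}=q$. For a smooth map $G$ on $D$, $d^mG(z)$ (or $\partial_x^mG(s,z)$ if $G$ also depends on time) denotes the $m$-th Fréchet derivative in the space variable at $z$, a symmetric $m$-multilinear map. An expression $d^mG(z)\,B_{j,m}(v_1,\ldots,v_{j-m+1})$ with $v_l\in\mathbb{R}^n$ means: each monomial of $B_{j,m}$ is a formal (symmetric) product of $m$ vectors, and the multilinear map is applied to those $m$ vectors, extended linearly. The integral of $B_{j,m}(\ldots)(s,z)$ in $s$ is understood in the same sense, so that $d^mG(z)\int_0^tB_{j,m}(\ldots)(s,z)\,ds=\int_0^td^mG(z)B_{j,m}(\ldots)(s,z)\,ds$. Melnikov functions: define $y_1(t,z)=\int_0^tF_1(s,z)\,ds$ and, for $i\in\{2,\ldots,k\}$, $$y_i(t,z)=\int_0^t\bigg(i!\,F_i(s,z)+\sum_{j=1}^{i-1}\sum_{m=1}^j\frac{i!}{j!}\,\partial_x^mF_{i-j}(s,z)\,B_{j,m}\big(y_1,\ldots,y_{j-m+1}\big)(s,z)\bigg)ds.$$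 Then $\mathbf{f}_i(z)=y_i(T,z)/i!$ for $i\in\{1,\ldots,k\}$. (It is a known fact that the solution $x(t,z,\varepsilon)$ with $x(0,z,\varepsilon)=z$ satisfies $x(t,z,\varepsilon)=z+\sum_{i=1}^k\varepsilon^iy_i(t,z)/i!+\mathcal{O}(\varepsilon^{k+1})$.) Stroboscopic averaged functions: it is a known fact that there exist smooth functions $\mathbf{u}_i:\mathbb{R}\times D\to\mathbb{R}^n$, $T$-periodic in $t$, and smooth functions $\mathbf{g}_i:D\to\mathbb{R}^n$, $i=1,\ldots,k$, such that the near-identity transformation $x=U(t,\xi,\varepsilon)=\xi+\sum_{i=1}^k\varepsilon^i\mathbf{u}_i(t,\xi)$ satisfies the stroboscopic condition $U(0,\xi,\varepsilon)=\xi$ and transforms the differential equation into $$\xi'=\sum_{i=1}^k\varepsilon^i\mathbf{g}_i(\xi)+\varepsilon^{k+1}r_k(t,\xi,\varepsilon)$$ with $r_k$ smooth and $T$-periodic in $t$. "Transforms" means that $$\partial_tU(t,\xi,\varepsilon)+\partial_\xi U(t,\xi,\varepsilon)\Big(\sum_{i=1}^k\varepsilon^i\mathbf{g}_i(\xi)+\varepsilon^{k+1}r_k(t,\xi,\varepsilon)\Big)=\sum_{i=1}^k\varepsilon^iF_i(t,U(t,\xi,\varepsilon))+\varepsilon^{k+1}R(t,U(t,\xi,\varepsilon),\varepsilon),$$ where, as usual, this is required locally: for each open $V$ with compact closure contained in $D$, there is $\varepsilon_V\in(0,\varepsilon_0]$ such that for $\xi\in V$ and $|\varepsilon|\le\varepsilon_V$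 one has $U(t,\xi,\varepsilon)\in D$ for all $t$ and $r_k$ is defined and smooth. The functions $\mathbf{g}_1,\ldots,\mathbf{g}_k$ are uniquely determined by these requirements; $\mathbf{g}_i$ is called the stroboscopic averaged function of order $i$. *)

theory Defs
  imports "HOL-Analysis.Analysis"
begin

primrec Ck_on :: "nat \<Rightarrow> ('a::euclidean_space \<Rightarrow> 'b::euclidean_space) \<Rightarrow> 'a set \<Rightarrow> bool" where
  "Ck_on 0 f S \<longleftrightarrow> continuous_on S f"
| "Ck_on (Suc n) f S \<longleftrightarrow>
     (\<forall>x\<in>S. f differentiable (at x)) \<and> (\<forall>v. Ck_on n (\<lambda>x. frechet_derivative f (at x) v) S)"

(* Smoothness on an arbitrary set means that f extends locally to a C^infinity function on an open
   set.  On an open S this is the usual notion; the general form is needed for closed parameter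
   intervals {-e..e}. *)
definition smooth_on :: "'a::euclidean_space set \<Rightarrow> ('a \<Rightarrow> 'b::euclidean_space) \<Rightarrow> bool" where
  "smooth_on S f \<longleftrightarrow>
     (\<forall>x\<in>S. \<exists>W h. open W \<and> x \<in> W \<and> (\<forall>n. Ck_on n h W) \<and> (\<forall>y\<in>S \<inter> W. h y = f y))"

(* nth_frechet G z [v1, ..., vm] is the m-th Frechet derivative of G at z applied to (v1, ..., vm);
   the order m is the length of the list.  For smooth G it is symmetric in the vectors. *)
primrec nth_frechet ::
  "('a::real_normed_vector \<Rightarrow> 'b::real_normed_vector) \<Rightarrow> 'a \<Rightarrow> 'a list \<Rightarrow> 'b" where
  "nth_frechet G z [] = G z"
| "nth_frechet G z (v # vs) = frechet_derivative (\<lambda>x. nth_frechet G x vs) (at z) v"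

definition bell_indices :: "nat \<Rightarrow> nat \<Rightarrow> (nat \<Rightarrow> nat) set" where
  "bell_indices p q =
     {b. (\<forall>j. j \<notin> {1..p - q + 1} \<longrightarrow> b j = 0) \<and>
         (\<Sum>j=1..p - q + 1. j * b j) = p \<and> (\<Sum>j=1..p - q + 1. b j) = q}"

(* The q-linear map L, given as a function on lists of length q, applied to the partial Bell
   polynomial B_{p,q}(v 1, ..., v (p - q + 1)): the monomial with exponents b stands for the list
   in which each v j is repeated b j times. *)
definition bell_apply ::
  "('a list \<Rightarrow> 'b::real_vector) \<Rightarrow> nat \<Rightarrow> nat \<Rightarrow> (nat \<Rightarrow> 'a) \<Rightarrow> 'b" where
  "bell_apply L p q v =
     (\<Sum>b\<in>bell_indices p q.
        (fact p / (\<Prod>j=1..p - q + 1. fact (b j)) * (\<Prod>j=1..p - q + 1. (1 / fact j) ^ b j)) *\<^sub>R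
        L (concat (map (\<lambda>j. replicate (b j) (v j)) [1..<p - q + 2])))"

lemma bell_apply_cong [fundef_cong]:
  assumes "L = L'" "p = p'" "q = q'" "\<And>j. j \<in> {1..p' - q' + 1} \<Longrightarrow> v j = v' j"
  shows "bell_apply L p q v = bell_apply L' p' q' v'"
proof -
  have eq: "map (\<lambda>j. replicate (b j) (v j)) [1..<p' - q' + 2] =
        map (\<lambda>j. replicate (b j) (v' j)) [1..<p' - q' + 2]" for b
    using assms(4) by (auto intro!: map_cong)
  show ?thesis
    unfolding bell_apply_def assms(1-3) by (simp only: eq)
qed

declare sum.cong [fundef_cong]

(* For i = 1 the double sum is empty, which leaves the integral of F 1.  The index i = 0 is never
   used. *)
function melnikov_y ::
  "(nat \<Rightarrow> real \<Rightarrow> 'a::euclidean_space \<Rightarrow> 'a) \<Rightarrow> nat \<Rightarrow> real \<Rightarrow> 'a \<Rightarrow> 'a" where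
  "melnikov_y F i t z =
     (LBINT s=0..t. fact i *\<^sub>R F i s z +
        (\<Sum>j=1..i - 1. \<Sum>m=1..j. (fact i / fact j) *\<^sub>R
           bell_apply (nth_frechet (F (i - j) s) z) j m (\<lambda>l. melnikov_y F l s z)))"
  by pat_completeness auto
termination
  by (relation "Wellfounded.measure (\<lambda>(F, i, t, z). i)") auto

declare melnikov_y.simps [simp del]

definition melnikov ::
  "(nat \<Rightarrow> real \<Rightarrow> 'a::euclidean_space \<Rightarrow> 'a) \<Rightarrow> real \<Rightarrow> nat \<Rightarrow> 'a \<Rightarrow> 'a" where
  "melnikov F T i z = (1 / fact i) *\<^sub>R melnikov_y F i T z"

definition near_identity ::
  "nat \<Rightarrow> (nat \<Rightarrow> real \<Rightarrow> 'a::real_vector \<Rightarrow> 'a) \<Rightarrow> real \<Rightarrow> 'a \<Rightarrow> real \<Rightarrow> 'a" where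
  "near_identity k u t \<xi> \<epsilon> = \<xi> + (\<Sum>i=1..k. \<epsilon> ^ i *\<^sub>R u i t \<xi>)"

definition stroboscopic_averaged ::
  "nat \<Rightarrow> 'a::euclidean_space set \<Rightarrow> real \<Rightarrow> real \<Rightarrow> (nat \<Rightarrow> real \<Rightarrow> 'a \<Rightarrow> 'a) \<Rightarrow>
   (real \<Rightarrow> 'a \<Rightarrow> real \<Rightarrow> 'a) \<Rightarrow> (nat \<Rightarrow> 'a \<Rightarrow> 'a) \<Rightarrow> bool" where
  "stroboscopic_averaged k D T \<epsilon>\<^sub>0 F R g \<longleftrightarrow>
     (\<forall>i\<in>{1..k}. smooth_on D (g i)) \<and>
     (\<exists>u r.
        (\<forall>i\<in>{1..k}. smooth_on (UNIV \<times> D) (\<lambda>(t, \<xi>). u i t \<xi>) \<and>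
                   (\<forall>t. \<forall>\<xi>\<in>D. u i (t + T) \<xi> = u i t \<xi>)) \<and>
        (\<forall>\<xi>\<in>D. \<forall>\<epsilon>\<in>{-\<epsilon>\<^sub>0..\<epsilon>\<^sub>0}. near_identity k u 0 \<xi> \<epsilon> = \<xi>) \<and>
        (\<forall>V. open V \<and> compact (closure V) \<and> closure V \<subseteq> D \<longrightarrow>
          (\<exists>\<epsilon>\<^sub>V. 0 < \<epsilon>\<^sub>V \<and> \<epsilon>\<^sub>V \<le> \<epsilon>\<^sub>0 \<and>
             smooth_on (UNIV \<times> V \<times> {-\<epsilon>\<^sub>V..\<epsilon>\<^sub>V}) (\<lambda>(t, \<xi>, \<epsilon>). r t \<xi> \<epsilon>) \<and>
             (\<forall>t. \<forall>\<xi>\<in>V. \<forall>\<epsilon>\<in>{-\<epsilon>\<^sub>V..\<epsilon>\<^sub>V}.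
                r (t + T) \<xi> \<epsilon> = r t \<xi> \<epsilon> \<and>
                near_identity k u t \<xi> \<epsilon> \<in> D \<and>
                vector_derivative (\<lambda>\<tau>. near_identity k u \<tau> \<xi> \<epsilon>) (at t) +
                frechet_derivative (\<lambda>x. near_identity k u t x \<epsilon>) (at \<xi>)
                  ((\<Sum>i=1..k. \<epsilon> ^ i *\<^sub>R g i \<xi>) + \<epsilon> ^ (k + 1) *\<^sub>R r t \<xi> \<epsilon>) =
                (\<Sum>i=1..k. \<epsilon> ^ i *\<^sub>R F i t (near_identity k u t \<xi> \<epsilon>)) +
                \<epsilon> ^ (k + 1) *\<^sub>R R t (near_identity k u t \<xi> \<epsilon>) \<epsilon>))))"

(* For i = 1 the double sum is empty, which leaves t times g 1 z. *)
function averaged_y ::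
  "(nat \<Rightarrow> 'a::euclidean_space \<Rightarrow> 'a) \<Rightarrow> nat \<Rightarrow> real \<Rightarrow> 'a \<Rightarrow> 'a" where
  "averaged_y g i t z =
     (fact i * t) *\<^sub>R g i z +
     (\<Sum>j=1..i - 1. \<Sum>m=1..j. (fact i / fact j) *\<^sub>R
        (LBINT s=0..t. bell_apply (nth_frechet (g (i - j)) z) j m (\<lambda>l. averaged_y g l s z)))"
  by pat_completeness auto
termination
  by (relation "Wellfounded.measure (\<lambda>(g, i, t, z). i)") auto

declare averaged_y.simps [simp del]

end

theory Submission
  imports Defs "HOL-Library.Landau_Symbols"
begin

text \<open>
  Fix \<open>z \<in> D\<close>. The averaged equation \<open>\<xi>' = \<Sum>\<^sub>i \<epsilon>\<^sup>i g\<^sub>i(\<xi>)\<close> has the approximate solution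
  \<open>X(t, \<epsilon>) = z + \<Sum>\<^sub>i \<epsilon>\<^sup>i y\<^sub>i(t) / i!\<close>, where \<open>y\<^sub>i\<close> is \<^const>\<open>averaged_y\<close>: by the Bell polynomial
  form of the Taylor expansion of a composition, the recursion for the \<open>y\<^sub>i\<close> says exactly that \<open>X\<close>
  solves the averaged equation up to \<open>O(\<epsilon>\<^bsup>k+1\<^esup>)\<close>. Transporting \<open>X\<close> by the near-identity map
  gives \<open>W(t, \<epsilon>) = U(t, X(t, \<epsilon>), \<epsilon>)\<close>, which solves the original equation up to
  \<open>O(\<epsilon>\<^bsup>k+1\<^esup>)\<close> and starts at \<open>W(0, \<epsilon>) = z\<close>. Reading the same composition formula backwards, the
  Taylor coefficients of \<open>W\<close> in \<open>\<epsilon>\<close>, multiplied by \<open>i!\<close>, satisfy the recursion that defines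
  \<^const>\<open>melnikov_y\<close>, so they are the functions \<^const>\<open>melnikov_y\<close>. The stroboscopic condition and the
  periodicity of \<open>U\<close> give \<open>W(T, \<epsilon>) = X(T, \<epsilon>)\<close>. Comparing Taylor coefficients at time \<open>T\<close> shows that
  \<^const>\<open>melnikov_y\<close> and \<^const>\<open>averaged_y\<close> agree there (\<open>melnikov_y_eq_averaged_y\<close>), and solving
  the recursion for \<^const>\<open>averaged_y\<close> at time \<open>T\<close> for \<open>g\<^sub>i(z)\<close> gives the formula of the theorem.

  All estimates in \<open>\<epsilon>\<close> are made for one fixed \<open>t\<close>, in terms of jets at \<open>\<epsilon> = 0\<close> (\<open>has_jet\<close>). Time enters
  only through the fact that the \<open>t\<close>-derivative of a Taylor coefficient of \<open>W\<close> is the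
  corresponding coefficient of \<open>\<partial>\<^sub>t W\<close> (\<open>jet_coeff_partial_derivative\<close>). This is the equality of mixed
  derivatives, applied to \<open>W\<close> as a smooth function of the pair \<open>(t, \<epsilon>)\<close> in a neighbourhood of
  the line \<open>\<epsilon> = 0\<close>.

  The composition formula (\<open>has_jet_compose\<close>) comes from Taylor expansion in one direction at a
  time: \<open>G(z + \<Sum>\<^sub>l \<epsilon>\<^sup>l w\<^sub>l / l!)\<close> is expanded first in the direction of the last \<open>w\<^sub>l\<close>, then in that of the
  one before, and so on down to \<open>w\<^sub>1\<close>. In this order each new derivative is put in front of the
  earlier ones, so that the vectors come out sorted as in \<^const>\<open>bell_apply\<close>, and the coefficient of
  \<open>\<epsilon>\<^sup>j\<close> is a sum over exponents \<open>b\<close> of weight \<open>\<Sum>\<^sub>l l b\<^sub>l = j\<close>. Grouping these by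
  \<open>\<Sum>\<^sub>l b\<^sub>l\<close> gives the partial Bell polynomials (\<open>taylor_coeff_eq_bell_sum\<close>).

  The polynomial form of \<^const>\<open>averaged_y\<close> follows from multilinearity of the derivatives
  (\<open>linear_nth_frechet\<close>): an argument that is a polynomial of degree \<open>l\<close> in time contributes at most \<open>l\<close>
  to the degree, a monomial of \<open>B\<^bsub>j,m\<^esub>\<close> has weight \<open>j\<close>, and integration adds one.
\<close>

section \<open>Functions of class \<open>C\<^sup>k\<close>\<close>

lemma Ck_on_subset: "Ck_on n f S \<Longrightarrow> T \<subseteq> S \<Longrightarrow> Ck_on n f T"
  by (induction n arbitrary: f) (auto intro: continuous_on_subset)

lemma Ck_on_imp_continuous_on: "Ck_on n f S \<Longrightarrow> continuous_on S f"
  by (cases n) (auto intro!: continuous_at_imp_continuous_on differentiable_imp_continuous_within)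

lemma Ck_on_SucD: "Ck_on (Suc n) f S \<Longrightarrow> Ck_on n f S"
proof (induction n arbitrary: f)
  case 0
  then show ?case using Ck_on_imp_continuous_on by (metis Ck_on.simps(1))
qed auto

lemma Ck_on_cong:
  assumes "open S" "\<And>x. x \<in> S \<Longrightarrow> f x = g x" "Ck_on n f S"
  shows "Ck_on n g S"
  using assms(2,3)
proof (induction n arbitrary: f g)
  case 0
  then show ?case by (simp cong: continuous_on_cong)
next
  case (Suc n)
  have "frechet_derivative f (at x) = frechet_derivative g (at x)" if "x \<in> S" for x
    using Suc.prems that by (intro frechet_derivative_transform_within_open[OF _ assms(1)]) auto
  moreover have "g differentiable (at x)" if "x \<in> S" for x
    using Suc.prems that unfolding differentiable_def
    by (metis (no_types, lifting) Ck_on.simps(2) assms(1) differentiable_def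
        has_derivative_transform_within_open)
  ultimately show ?case
    using Suc.prems Suc.IH[of "\<lambda>x. frechet_derivative f (at x) v" "\<lambda>x. frechet_derivative g (at x) v" for v]
    by auto
qed

lemma Ck_on_local:
  assumes "\<And>x. x \<in> S \<Longrightarrow> \<exists>W. open W \<and> x \<in> W \<and> Ck_on n f W"
  shows "Ck_on n f S"
  using assms
proof (induction n arbitrary: f)
  case 0
  then show ?case
    by (simp, metis continuous_at_imp_continuous_on continuous_on_eq_continuous_at)
next
  case (Suc n)
  have "f differentiable (at x)" if "x \<in> S" for x
    using Suc.prems[OF that] by auto
  moreover have "Ck_on n (\<lambda>x. frechet_derivative f (at x) v) S" for v
    by (rule Suc.IH) (use Suc.prems in \<open>auto, blast\<close>)
  ultimately show ?case by simp
qed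

text \<open>
  On an open set the local extensions in the definition of smoothness agree with the function
  near each point, and being \<open>C\<^sup>k\<close> is a local property.
\<close>

lemma smooth_on_open_imp_Ck_on:
  assumes "open S" "smooth_on S f"
  shows "Ck_on n f S"
proof (rule Ck_on_local)
  fix x assume "x \<in> S"
  then obtain W h where W: "open W" "x \<in> W" "Ck_on n h W" "\<forall>y\<in>S \<inter> W. h y = f y"
    using assms(2) unfolding smooth_on_def by blast
  have "Ck_on n f (S \<inter> W)"
    by (rule Ck_on_cong[of _ h])
      (use W assms(1) in \<open>auto intro: Ck_on_subset\<close>)
  then show "\<exists>W. open W \<and> x \<in> W \<and> Ck_on n f W"
    using W assms(1) \<open>x \<in> S\<close> by (intro exI[of _ "S \<inter> W"]) auto
qed

lemma smooth_on_imp_continuous_on: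
  assumes "smooth_on S f"
  shows "continuous_on S f"
  unfolding continuous_on_eq_continuous_within
proof
  fix x assume "x \<in> S"
  then obtain W h where W: "open W" "x \<in> W" "Ck_on 0 h W" "\<forall>y\<in>S \<inter> W. h y = f y"
    using assms unfolding smooth_on_def by blast
  have "continuous (at x within S) h"
    using W by (simp add: continuous_on_eq_continuous_at continuous_at_imp_continuous_at_within)
  then show "continuous (at x within S) f"
    by (rule continuous_transform_within_openin[of _ _ _ "S \<inter> W"])
      (use W \<open>x \<in> S\<close> in auto)
qed

lemma Ck_on_Suc_derivI:
  assumes "open S" "\<And>x. x \<in> S \<Longrightarrow> (f has_derivative f' x) (at x)"
    and "\<And>v. Ck_on n (\<lambda>x. f' x v) S"
  shows "Ck_on (Suc n) f S"
proof -
  have "f' x v = frechet_derivative f (at x) v" if "x \<in> S" for x v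
    using frechet_derivative_at[OF assms(2)[OF that]] by simp
  then have "Ck_on n (\<lambda>x. frechet_derivative f (at x) v) S" for v
    using Ck_on_cong[OF assms(1) _ assms(3)[of v], of "\<lambda>x. frechet_derivative f (at x) v"] by simp
  then show ?thesis
    using assms(2) by (auto simp: differentiable_def)
qed

lemma Ck_on_Suc_has_derivative:
  "Ck_on (Suc n) f S \<Longrightarrow> x \<in> S \<Longrightarrow> (f has_derivative frechet_derivative f (at x)) (at x)"
  by (simp add: frechet_derivative_works)

lemma Ck_on_const: "Ck_on n (\<lambda>x. c) S"
  by (induction n arbitrary: c) auto

lemma Ck_on_bounded_linear: "open S \<Longrightarrow> bounded_linear f \<Longrightarrow> Ck_on n f S"
proof (cases n)
  case 0
  then show "bounded_linear f \<Longrightarrow> ?thesis" by (simp add: linear_continuous_on)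
next
  case (Suc m)
  then show "open S \<Longrightarrow> bounded_linear f \<Longrightarrow> ?thesis"
    by (auto intro!: Ck_on_Suc_derivI[where f' = "\<lambda>_. f"] bounded_linear_imp_has_derivative Ck_on_const
             simp del: Ck_on.simps)
qed

lemma Ck_on_bounded_linear_compose:
  assumes "bounded_linear L"
  shows "open S \<Longrightarrow> Ck_on n f S \<Longrightarrow> Ck_on n (\<lambda>x. L (f x)) S"
proof (induction n arbitrary: f)
  case 0
  then show ?case by (auto intro: bounded_linear.continuous_on[OF assms])
next
  case (Suc n)
  show ?case
    by (rule Ck_on_Suc_derivI[OF Suc.prems(1)
          bounded_linear.has_derivative[OF assms Ck_on_Suc_has_derivative[OF Suc.prems(2)]]])
      (use Suc in auto)
qed

lemma Ck_on_add:
  "open S \<Longrightarrow> Ck_on n f S \<Longrightarrow> Ck_on n g S \<Longrightarrow> Ck_on n (\<lambda>x. f x + g x) S"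
proof (induction n arbitrary: f g)
  case (Suc n)
  show ?case
    by (rule Ck_on_Suc_derivI[OF Suc.prems(1)
          has_derivative_add[OF Ck_on_Suc_has_derivative[OF Suc.prems(2)] Ck_on_Suc_has_derivative[OF Suc.prems(3)]]])
      (use Suc in auto)
qed (auto intro: continuous_intros)

lemma Ck_on_sum:
  "open S \<Longrightarrow> (\<And>i. i \<in> I \<Longrightarrow> Ck_on n (f i) S) \<Longrightarrow> Ck_on n (\<lambda>x. \<Sum>i\<in>I. f i x) S"
  by (induction I rule: infinite_finite_induct) (auto intro: Ck_on_const Ck_on_add)

lemma Ck_on_scaleR:
  "open S \<Longrightarrow> Ck_on n f S \<Longrightarrow> Ck_on n g S \<Longrightarrow> Ck_on n (\<lambda>x. f x *\<^sub>R g x) S"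
proof (induction n arbitrary: f g)
  case (Suc n)
  note lower = Ck_on_SucD[OF Suc.prems(2)] Ck_on_SucD[OF Suc.prems(3)]
  show ?case
    by (rule Ck_on_Suc_derivI[OF Suc.prems(1)
          has_derivative_scaleR[OF Ck_on_Suc_has_derivative[OF Suc.prems(2)] Ck_on_Suc_has_derivative[OF Suc.prems(3)]]])
      (use Suc lower in \<open>auto intro!: Ck_on_add\<close>)
qed (auto intro: continuous_intros)

lemma Ck_on_Pair:
  "open S \<Longrightarrow> Ck_on n f S \<Longrightarrow> Ck_on n g S \<Longrightarrow> Ck_on n (\<lambda>x. (f x, g x)) S"
proof (induction n arbitrary: f g)
  case (Suc n)
  show ?case
    by (rule Ck_on_Suc_derivI[OF Suc.prems(1)
          has_derivative_Pair[OF Ck_on_Suc_has_derivative[OF Suc.prems(2)] Ck_on_Suc_has_derivative[OF Suc.prems(3)]]])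
      (use Suc in auto)
qed (auto intro: continuous_intros)

lemma linear_Basis_expansion:
  fixes L :: "'a::euclidean_space \<Rightarrow> 'b::real_vector"
  assumes "linear L"
  shows "L v = (\<Sum>b\<in>Basis. (v \<bullet> b) *\<^sub>R L b)"
proof -
  have "L v = L (\<Sum>b\<in>Basis. (v \<bullet> b) *\<^sub>R b)"
    by (simp add: euclidean_representation)
  also have "\<dots> = (\<Sum>b\<in>Basis. (v \<bullet> b) *\<^sub>R L b)"
    by (simp only: linear_sum[OF assms] linear_scale[OF assms])
  finally show ?thesis .
qed

text \<open>
  The derivative of \<open>f \<circ> g\<close> in a direction \<open>v\<close> is \<open>f' (g x) (g' x v)\<close>, where the direction
  of \<open>f'\<close> varies with \<open>x\<close> while \<^const>\<open>Ck_on\<close> speaks about fixed directions only. Expanding \<open>g' x v\<close> in the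
  standard basis leaves products of scalar functions with compositions \<open>f' (g x) b\<close>, to which
  the induction hypothesis applies.
\<close>

lemma Ck_on_compose:
  assumes "open S" "open T"
  shows "Ck_on n f S \<Longrightarrow> Ck_on n g T \<Longrightarrow> g ` T \<subseteq> S \<Longrightarrow> Ck_on n (\<lambda>x. f (g x)) T"
proof (induction n arbitrary: f g)
  case 0
  then show ?case by (auto intro: continuous_on_compose2)
next
  case (Suc n)
  define f' where "f' = (\<lambda>x v. frechet_derivative f (at x) v)"
  define g' where "g' = (\<lambda>x v. frechet_derivative g (at x) v)"
  have f': "(f has_derivative f' y) (at y)" "Ck_on n (\<lambda>y. f' y v) S" if "y \<in> S" for y v
    using Suc.prems that unfolding f'_def by (auto simp: frechet_derivative_works)
  have g': "(g has_derivative g' x) (at x)" "Ck_on n (\<lambda>y. g' y v) T" if "x \<in> T" for x v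
    using Suc.prems that unfolding g'_def by (auto simp: frechet_derivative_works)
  have gn: "Ck_on n g T" using Suc.prems(2) by (rule Ck_on_SucD)
  show ?case
  proof (rule Ck_on_Suc_derivI[OF assms(2)])
    show "((\<lambda>x. f (g x)) has_derivative (\<lambda>v. \<Sum>b\<in>Basis. (g' x v \<bullet> b) *\<^sub>R f' (g x) b)) (at x)" if "x \<in> T" for x
    proof -
      have S: "g x \<in> S" using that Suc.prems by auto
      have "((\<lambda>x. f (g x)) has_derivative (\<lambda>v. f' (g x) (g' x v))) (at x)"
        using has_derivative_compose[OF g'(1)[OF that] f'(1)[OF S]] .
      then show ?thesis
        by (subst (asm) linear_Basis_expansion[OF has_derivative_linear[OF f'(1)[OF S]]])
    qed
    have "Ck_on n (\<lambda>x. g' x v) T" for v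
      using Suc.prems unfolding g'_def by simp
    moreover have "Ck_on n (\<lambda>x. f' (g x) b) T" for b
      using Suc.IH[of "\<lambda>y. f' y b" g] Suc.prems gn unfolding f'_def by simp
    ultimately show "Ck_on n (\<lambda>x. \<Sum>b\<in>Basis. (g' x v \<bullet> b) *\<^sub>R f' (g x) b) T" for v
      by (intro Ck_on_sum Ck_on_scaleR Ck_on_bounded_linear_compose[OF bounded_linear_inner_left] assms(2))
  qed
qed

lemma Ck_on_power:
  fixes h :: "'a::euclidean_space \<Rightarrow> real"
  assumes "open S" "Ck_on n h S"
  shows "Ck_on n (\<lambda>x. h x ^ l) S"
proof (induction l)
  case (Suc l)
  show ?case using Ck_on_scaleR[OF assms(1) assms(2) Suc] by simp
qed (simp add: Ck_on_const)

abbreviation Cinf_on :: "('a::euclidean_space \<Rightarrow> 'b::euclidean_space) \<Rightarrow> 'a set \<Rightarrow> bool"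
  where "Cinf_on f S \<equiv> (\<forall>n. Ck_on n f S)"

lemma Cinf_on_slice:
  assumes "open D" "smooth_on (UNIV \<times> D) (\<lambda>(t :: real, x). f t x)"
  shows "Cinf_on (f t) D"
proof
  fix n
  have "Ck_on n (\<lambda>(t, x). f t x) (UNIV \<times> D)"
    using assms by (intro smooth_on_open_imp_Ck_on open_Times) auto
  moreover have "Ck_on n (\<lambda>x. (t, x)) D"
    by (intro Ck_on_Pair Ck_on_const Ck_on_bounded_linear assms bounded_linear_ident)
  ultimately have "Ck_on n (\<lambda>x. (\<lambda>(t, x). f t x) (t, x)) D"
    by (rule Ck_on_compose[OF open_Times[OF open_UNIV assms(1)] assms(1)]) auto
  then show "Ck_on n (f t) D" by simp
qed

section \<open>Iterated directional derivatives\<close>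

lemma Cinf_on_nth_frechet:
  "Cinf_on G S \<Longrightarrow> Cinf_on (\<lambda>x. nth_frechet G x vs) S"
proof (induction vs)
  case (Cons v vs)
  then have "Ck_on (Suc n) (\<lambda>x. nth_frechet G x vs) S" for n
    by blast
  then show ?case by simp
qed simp

lemma nth_frechet_append:
  "nth_frechet (\<lambda>x. nth_frechet G x ws) z vs = nth_frechet G z (vs @ ws)"
  by (induction vs arbitrary: z) auto

lemma nth_frechet_has_derivative:
  assumes "Cinf_on G S" "x \<in> S"
  shows "((\<lambda>x. nth_frechet G x vs) has_derivative (\<lambda>v. nth_frechet G x (v # vs))) (at x)"
  using Ck_on_Suc_has_derivative[of 0 "\<lambda>x. nth_frechet G x vs" S x] Cinf_on_nth_frechet[OF assms(1)] assms(2)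
  by (simp del: Ck_on.simps)

text \<open>
  For the outermost argument this is linearity of the Frechet derivative. For an inner
  argument, linearity holds at all points of the open set by induction, and differentiating the
  identity preserves it.
\<close>

lemma linear_nth_frechet:
  assumes "open S" "Cinf_on G S" "z \<in> S"
  shows "linear (\<lambda>v. nth_frechet G z (as @ v # bs))"
  using assms(3)
proof (induction as arbitrary: z)
  case Nil
  then show ?case
    using has_derivative_linear[OF nth_frechet_has_derivative[OF assms(2), of z bs]] by simp
next
  case (Cons a as)
  let ?N = "\<lambda>x v. nth_frechet G x (as @ v # bs)"
  have der: "((\<lambda>x. ?N x v) has_derivative (\<lambda>w. nth_frechet G z (w # as @ v # bs))) (at z)" for v
    using nth_frechet_has_derivative[OF assms(2) Cons.prems] .
  show ?case
  proof (rule linearI)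
    fix v w
    have "((\<lambda>x. ?N x v + ?N x w) has_derivative
        (\<lambda>a. nth_frechet G z (a # as @ v # bs) + nth_frechet G z (a # as @ w # bs))) (at z)"
      by (intro has_derivative_add der)
    then have "((\<lambda>x. ?N x (v + w)) has_derivative
        (\<lambda>a. nth_frechet G z (a # as @ v # bs) + nth_frechet G z (a # as @ w # bs))) (at z)"
      by (rule has_derivative_transform_within_open[OF _ assms(1) Cons.prems])
        (simp add: linear_add[OF Cons.IH])
    from fun_cong[OF has_derivative_unique[OF der[of "v + w"] this], of a]
    show "nth_frechet G z ((a # as) @ (v + w) # bs)
        = nth_frechet G z ((a # as) @ v # bs) + nth_frechet G z ((a # as) @ w # bs)"
      by simp
  next
    fix c v
    have "((\<lambda>x. c *\<^sub>R ?N x v) has_derivative (\<lambda>a. c *\<^sub>R nth_frechet G z (a # as @ v # bs))) (at z)"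
      by (intro has_derivative_scaleR_right der)
    then have "((\<lambda>x. ?N x (c *\<^sub>R v)) has_derivative (\<lambda>a. c *\<^sub>R nth_frechet G z (a # as @ v # bs))) (at z)"
      by (rule has_derivative_transform_within_open[OF _ assms(1) Cons.prems])
        (simp add: linear_scale[OF Cons.IH])
    from fun_cong[OF has_derivative_unique[OF der[of "c *\<^sub>R v"] this], of a]
    show "nth_frechet G z ((a # as) @ (c *\<^sub>R v) # bs) = c *\<^sub>R nth_frechet G z ((a # as) @ v # bs)"
      by simp
  qed
qed

lemma Cinf_on_derivative_locally_bounded:
  assumes "open S" "Cinf_on f S" "x0 \<in> S"
  obtains C r where "r > 0" "cball x0 r \<subseteq> S"
    "\<And>x v. x \<in> cball x0 r \<Longrightarrow> norm (frechet_derivative f (at x) v) \<le> C * norm v"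
proof -
  obtain r where r: "r > 0" "cball x0 r \<subseteq> S"
    using assms open_contains_cball by blast
  have C1: "Ck_on (Suc 0) f S" using assms by blast
  let ?h = "\<lambda>x. \<Sum>b\<in>Basis. norm (frechet_derivative f (at x) b)"
  have "continuous_on (cball x0 r) ?h"
    using C1 r by (auto intro!: continuous_intros intro: continuous_on_subset)
  then have "bounded (?h ` cball x0 r)"
    by (intro compact_imp_bounded compact_continuous_image compact_cball)
  then obtain C where C: "\<forall>x\<in>cball x0 r. norm (?h x) \<le> C"
    unfolding bounded_iff by auto
  have "norm (frechet_derivative f (at x) v) \<le> C * norm v" if x: "x \<in> cball x0 r" for x v
  proof -
    have lin: "linear (frechet_derivative f (at x))"
      using C1 x r by (intro linear_frechet_derivative) auto
    have "norm (frechet_derivative f (at x) v) \<le> (\<Sum>b\<in>Basis. norm ((v \<bullet> b) *\<^sub>R frechet_derivative f (at x) b))"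
      by (subst linear_Basis_expansion[OF lin]) (rule norm_sum)
    also have "\<dots> \<le> (\<Sum>b\<in>Basis. norm v * norm (frechet_derivative f (at x) b))"
      by (intro sum_mono) (auto intro!: mult_right_mono Basis_le_norm)
    also have "\<dots> = ?h x * norm v"
      by (subst mult.commute) (simp only: sum_distrib_left)
    also have "\<dots> \<le> C * norm v"
      using C x by (intro mult_right_mono) (auto simp: abs_le_iff)
    finally show ?thesis .
  qed
  with r show ?thesis by (rule that)
qed

lemma Cinf_on_locally_Lipschitz:
  assumes "open S" "Cinf_on f S" "x0 \<in> S"
  obtains C r where "r > 0" "cball x0 r \<subseteq> S"
    "\<And>x y. x \<in> cball x0 r \<Longrightarrow> y \<in> cball x0 r \<Longrightarrow> norm (f x - f y) \<le> C * norm (x - y)"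
proof -
  obtain C r where r: "r > 0" "cball x0 r \<subseteq> S"
    and C: "\<And>x v. x \<in> cball x0 r \<Longrightarrow> norm (frechet_derivative f (at x) v) \<le> C * norm v"
    by (rule Cinf_on_derivative_locally_bounded[OF assms]) (rule that)
  have "norm (f x - f y) \<le> C * norm (x - y)" if "x \<in> cball x0 r" "y \<in> cball x0 r" for x y
  proof (rule differentiable_bound[OF convex_cball _ _ that])
    fix x assume x: "x \<in> cball x0 r"
    show "(f has_derivative frechet_derivative f (at x)) (at x within cball x0 r)"
      by (rule has_derivative_at_withinI, rule Ck_on_Suc_has_derivative[OF assms(2)[THEN spec, of "Suc 0"] subsetD[OF r(2) x]])
    show "onorm (frechet_derivative f (at x)) \<le> C"
      using C[OF x] by (intro onorm_le) auto
  qed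
  with r show ?thesis by (rule that)
qed

text \<open>
  The derivative of the remainder of order \<open>p + 1\<close> is the remainder of order \<open>p\<close> of the
  derivative, so that the mean value inequality raises the order by one in each step. The constant is
  not optimal; only the power of \<open>h\<close> matters below.
\<close>

lemma vector_Taylor_bound:
  fixes d :: "nat \<Rightarrow> real \<Rightarrow> 'b::real_normed_vector"
  assumes "\<And>m s. m \<le> p \<Longrightarrow> \<bar>s\<bar> \<le> \<bar>h\<bar> \<Longrightarrow> (d m has_vector_derivative d (Suc m) s) (at s)"
    and "\<And>s. \<bar>s\<bar> \<le> \<bar>h\<bar> \<Longrightarrow> norm (d (Suc p) s) \<le> B"
  shows "norm (d 0 h - (\<Sum>c\<le>p. (h ^ c / fact c) *\<^sub>R d c 0)) \<le> B * \<bar>h\<bar> ^ Suc p"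
  using assms
proof (induction p arbitrary: d h)
  case 0
  have "norm (d 0 h - d 0 0) \<le> B * norm (h - 0)"
  proof (rule differentiable_bound[of "{-\<bar>h\<bar>..\<bar>h\<bar>}" "d 0" "\<lambda>s v. v *\<^sub>R d 1 s"])
    fix s assume "s \<in> {-\<bar>h\<bar>..\<bar>h\<bar>}"
    then have s: "\<bar>s\<bar> \<le> \<bar>h\<bar>" by auto
    show "(d 0 has_derivative (\<lambda>v. v *\<^sub>R d 1 s)) (at s within {-\<bar>h\<bar>..\<bar>h\<bar>})"
      using 0(1)[of 0 s] s by (auto simp: has_vector_derivative_def intro: has_derivative_at_withinI)
    show "onorm (\<lambda>v. v *\<^sub>R d 1 s) \<le> B"
      using 0(2)[OF s] by (intro onorm_le) (simp add: mult.commute[of B] mult_left_mono)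
  qed auto
  then show ?case by simp
next
  case (Suc p)
  \<comment> \<open>The remainder \<open>?e\<close> and its derivative \<open>?e'\<close>, which is the remainder of order \<open>p\<close> for \<open>d 1\<close>.\<close>
  let ?e = "\<lambda>s. d 0 s - (\<Sum>c\<le>Suc p. (s ^ c / fact c) *\<^sub>R d c 0)"
  let ?e' = "\<lambda>s. d 1 s - (\<Sum>c\<le>p. (s ^ c / fact c) *\<^sub>R d (Suc c) 0)"
  have e': "norm (?e' s) \<le> B * \<bar>s\<bar> ^ Suc p" if "\<bar>s\<bar> \<le> \<bar>h\<bar>" for s
    using Suc.IH[of s "\<lambda>m. d (Suc m)"] Suc.prems that by auto
  have e'h: "norm (?e' s) \<le> B * \<bar>h\<bar> ^ Suc p" if "\<bar>s\<bar> \<le> \<bar>h\<bar>" for s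
  proof -
    have "B \<ge> 0" using order_trans[OF norm_ge_zero Suc.prems(2)[of 0]] by simp
    then have "B * \<bar>s\<bar> ^ Suc p \<le> B * \<bar>h\<bar> ^ Suc p"
      using that by (intro mult_left_mono power_mono) auto
    with e'[OF that] show ?thesis by linarith
  qed
  have "norm (?e h - ?e 0) \<le> (B * \<bar>h\<bar> ^ Suc p) * norm (h - 0)"
  proof (rule differentiable_bound[of "{-\<bar>h\<bar>..\<bar>h\<bar>}" ?e "\<lambda>s v. v *\<^sub>R ?e' s"])
    fix s assume "s \<in> {-\<bar>h\<bar>..\<bar>h\<bar>}"
    then have s: "\<bar>s\<bar> \<le> \<bar>h\<bar>" by auto
    have pow: "((\<lambda>s. s ^ Suc c / fact (Suc c)) has_real_derivative s ^ c / fact c) (at s)" for c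
    proof -
      have "((\<lambda>s. s ^ Suc c / fact (Suc c)) has_real_derivative real (Suc c) * s ^ c / fact (Suc c)) (at s)"
        using DERIV_pow[of "Suc c" s] by (intro DERIV_cdivide) simp
      then show ?thesis by (simp add: fact_Suc del: of_nat_Suc)
    qed
    have "((\<lambda>s. (\<Sum>c\<le>Suc p. (s ^ c / fact c) *\<^sub>R d c 0)) has_vector_derivative
        (\<Sum>c\<le>p. (s ^ c / fact c) *\<^sub>R d (Suc c) 0)) (at s)"
      unfolding sum.atMost_Suc_shift
      by (auto intro!: derivative_eq_intros has_vector_derivative_scaleR[OF pow, THEN has_vector_derivative_eq_rhs] simp del: power_Suc fact_Suc)
    then have "(?e has_vector_derivative ?e' s) (at s)"
      using Suc.prems(1)[of 0 s] s by (intro has_vector_derivative_diff) auto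
    then show "(?e has_derivative (\<lambda>v. v *\<^sub>R ?e' s)) (at s within {-\<bar>h\<bar>..\<bar>h\<bar>})"
      by (auto simp: has_vector_derivative_def intro: has_derivative_at_withinI)
    show "onorm (\<lambda>v. v *\<^sub>R ?e' s) \<le> B * \<bar>h\<bar> ^ Suc p"
      using e'h[OF s] by (intro onorm_le) (simp add: mult.commute[of "B * _"] mult_left_mono)
  qed auto
  moreover have "?e 0 = 0"
    unfolding sum.atMost_Suc_shift by simp
  ultimately show ?case
    by (simp add: algebra_simps)
qed

text \<open>
  The constant \<open>B\<close> is uniform over base points \<open>x\<close> in a ball, since the expansion is used
  at base points that move with \<open>\<epsilon>\<close>.
\<close>

lemma directional_Taylor_bound:
  assumes "open S" "Cinf_on G S" "cball z r \<subseteq> S"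
    and "\<And>x. x \<in> cball z r \<Longrightarrow> norm (nth_frechet G x (replicate (Suc p) y)) \<le> B"
    and "norm (x - z) + \<bar>h\<bar> * norm y \<le> r"
  shows "norm (G (x + h *\<^sub>R y) - (\<Sum>c\<le>p. (h ^ c / fact c) *\<^sub>R nth_frechet G x (replicate c y)))
    \<le> B * \<bar>h\<bar> ^ Suc p"
proof -
  have inb: "x + s *\<^sub>R y \<in> cball z r" if "\<bar>s\<bar> \<le> \<bar>h\<bar>" for s
  proof -
    have "norm (x + s *\<^sub>R y - z) \<le> norm (x - z) + norm (s *\<^sub>R y)"
      by (metis add_diff_eq add.commute diff_add_eq norm_triangle_ineq)
    also have "\<dots> \<le> norm (x - z) + \<bar>h\<bar> * norm y"
      using that by (auto intro: mult_right_mono)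
    finally show ?thesis
      using assms(5) by (simp add: dist_norm norm_minus_commute)
  qed
  have "norm (nth_frechet G (x + h *\<^sub>R y) (replicate 0 y) -
      (\<Sum>c\<le>p. (h ^ c / fact c) *\<^sub>R nth_frechet G (x + 0 *\<^sub>R y) (replicate c y))) \<le> B * \<bar>h\<bar> ^ Suc p"
  proof (rule vector_Taylor_bound)
    fix m s assume s: "\<bar>s\<bar> \<le> \<bar>h\<bar>"
    have 1: "((\<lambda>s. x + s *\<^sub>R y) has_derivative (\<lambda>v. v *\<^sub>R y)) (at s)"
      by (auto intro!: derivative_eq_intros)
    have X: "x + s *\<^sub>R y \<in> S" using inb[OF s] assms(3) by auto
    have lin: "linear (\<lambda>v. nth_frechet G (x + s *\<^sub>R y) (v # replicate m y))"
      using has_derivative_linear[OF nth_frechet_has_derivative[OF assms(2) X]] .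
    show "((\<lambda>s. nth_frechet G (x + s *\<^sub>R y) (replicate m y)) has_vector_derivative
        nth_frechet G (x + s *\<^sub>R y) (replicate (Suc m) y)) (at s)"
      using has_derivative_compose[OF 1 nth_frechet_has_derivative[OF assms(2) X], of "replicate m y"]
      unfolding has_vector_derivative_def
      by (simp add: linear_scale[OF lin] del: nth_frechet.simps)
  qed (use inb assms in auto)
  then show ?thesis by simp
qed

section \<open>Jets at zero\<close>

definition is_O_power :: "nat \<Rightarrow> (real \<Rightarrow> 'b::real_normed_vector) \<Rightarrow> bool" where
  "is_O_power q f \<longleftrightarrow> (\<lambda>\<epsilon>. norm (f \<epsilon>)) \<in> O[at 0](\<lambda>\<epsilon>. \<epsilon> ^ q)"

lemma is_O_power_iff: "is_O_power q f \<longleftrightarrow> (\<exists>C. \<forall>\<^sub>F \<epsilon> in at 0. norm (f \<epsilon>) \<le> C * \<bar>\<epsilon>\<bar> ^ q)"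
proof
  assume "is_O_power q f"
  then obtain C where "\<forall>\<^sub>F \<epsilon> in at 0. norm (norm (f \<epsilon>)) \<le> C * norm (\<epsilon> ^ q)"
    unfolding is_O_power_def by (rule landau_o.bigE)
  then show "\<exists>C. \<forall>\<^sub>F \<epsilon> in at 0. norm (f \<epsilon>) \<le> C * \<bar>\<epsilon>\<bar> ^ q"
    by (auto simp: power_abs)
next
  assume "\<exists>C. \<forall>\<^sub>F \<epsilon> in at 0. norm (f \<epsilon>) \<le> C * \<bar>\<epsilon>\<bar> ^ q"
  then show "is_O_power q f"
    unfolding is_O_power_def by (auto simp: power_abs intro: bigoI)
qed

lemma O_powerI: "(\<forall>\<^sub>F \<epsilon> in at 0. norm (f \<epsilon>) \<le> C * \<bar>\<epsilon>\<bar> ^ q) \<Longrightarrow> is_O_power q f"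
  unfolding is_O_power_iff by blast

lemma O_power_dominated:
  assumes "is_O_power q f" "\<forall>\<^sub>F \<epsilon> in at 0. norm (g \<epsilon>) \<le> C * norm (f \<epsilon>)"
  shows "is_O_power q g"
proof -
  have "(\<lambda>\<epsilon>. norm (g \<epsilon>)) \<in> O[at 0](\<lambda>\<epsilon>. norm (f \<epsilon>))"
    using assms(2) by (intro bigoI[of _ C]) auto
  then show ?thesis
    using assms(1) unfolding is_O_power_def by (rule landau_o.big_trans)
qed

lemma O_power_cong: "(\<forall>\<^sub>F \<epsilon> in at 0. f \<epsilon> = g \<epsilon>) \<Longrightarrow> is_O_power q f \<Longrightarrow> is_O_power q g"
  by (erule O_power_dominated[of _ _ _ 1]) (auto elim: eventually_mono)

lemma O_power_zero: "is_O_power q (\<lambda>_. 0)"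
  by (simp add: is_O_power_def)

lemma O_power_add:
  assumes "is_O_power q f" "is_O_power q g"
  shows "is_O_power q (\<lambda>\<epsilon>. f \<epsilon> + g \<epsilon>)"
proof -
  have "is_O_power q (\<lambda>\<epsilon>. norm (f \<epsilon>) + norm (g \<epsilon>))"
    using assms unfolding is_O_power_def by (simp add: sum_in_bigo)
  then show ?thesis
    by (rule O_power_dominated[of _ _ _ 1]) (auto intro!: always_eventually norm_triangle_ineq)
qed

lemma O_power_scaleR: "is_O_power q f \<Longrightarrow> is_O_power q (\<lambda>\<epsilon>. c *\<^sub>R f \<epsilon>)"
  by (erule O_power_dominated[of _ _ _ "\<bar>c\<bar>"]) simp

lemma O_power_diff: "is_O_power q f \<Longrightarrow> is_O_power q g \<Longrightarrow> is_O_power q (\<lambda>\<epsilon>. f \<epsilon> - g \<epsilon>)"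
  using O_power_add[of q f "\<lambda>\<epsilon>. (-1) *\<^sub>R g \<epsilon>"] O_power_scaleR[of q g "-1"] by simp

lemma O_power_sum: "(\<And>i. i \<in> I \<Longrightarrow> is_O_power q (f i)) \<Longrightarrow> is_O_power q (\<lambda>\<epsilon>. \<Sum>i\<in>I. f i \<epsilon>)"
  by (induction I rule: infinite_finite_induct) (auto intro: O_power_zero O_power_add)

lemma O_power_power_scaleR:
  assumes "is_O_power q f"
  shows "is_O_power (i + q) (\<lambda>\<epsilon>. \<epsilon> ^ i *\<^sub>R f \<epsilon>)"
proof -
  obtain C where "\<forall>\<^sub>F \<epsilon> in at 0. norm (f \<epsilon>) \<le> C * \<bar>\<epsilon>\<bar> ^ q"
    using assms unfolding is_O_power_iff by blast
  then have "\<forall>\<^sub>F \<epsilon> in at 0. norm (\<epsilon> ^ i *\<^sub>R f \<epsilon>) \<le> C * \<bar>\<epsilon>\<bar> ^ (i + q)"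
  proof eventually_elim
    case (elim \<epsilon>)
    then have "\<bar>\<epsilon>\<bar> ^ i * norm (f \<epsilon>) \<le> \<bar>\<epsilon>\<bar> ^ i * (C * \<bar>\<epsilon>\<bar> ^ q)"
      by (intro mult_left_mono) auto
    then show ?case by (simp add: power_add power_abs mult_ac)
  qed
  then show ?thesis by (rule O_powerI)
qed

lemma O_power_mono:
  assumes "is_O_power q f" "q' \<le> q"
  shows "is_O_power q' f"
proof -
  obtain C where C: "\<forall>\<^sub>F \<epsilon> in at 0. norm (f \<epsilon>) \<le> C * \<bar>\<epsilon>\<bar> ^ q"
    using assms unfolding is_O_power_iff by blast
  have "\<forall>\<^sub>F \<epsilon> in at (0::real). \<bar>\<epsilon>\<bar> < 1"
    by (auto simp: eventually_at intro!: exI[of _ 1])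
  with C have "\<forall>\<^sub>F \<epsilon> in at 0. norm (f \<epsilon>) \<le> \<bar>C\<bar> * \<bar>\<epsilon>\<bar> ^ q'"
  proof eventually_elim
    case (elim \<epsilon>)
    have "C * \<bar>\<epsilon>\<bar> ^ q \<le> \<bar>C\<bar> * \<bar>\<epsilon>\<bar> ^ q'"
      using elim(2) assms(2) by (intro mult_mono power_decreasing) auto
    with elim(1) show ?case by linarith
  qed
  then show ?thesis by (rule O_powerI)
qed

lemma O_power_tendsto:
  assumes "(f \<longlongrightarrow> l) (at 0)"
  shows "is_O_power 0 f"
proof (rule O_powerI[of _ "norm l + 1"])
  have "\<forall>\<^sub>F \<epsilon> in at 0. norm (f \<epsilon>) < norm l + 1"
    using tendsto_norm[OF assms] by (rule order_tendstoD) simp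
  then show "\<forall>\<^sub>F \<epsilon> in at 0. norm (f \<epsilon>) \<le> (norm l + 1) * \<bar>\<epsilon>\<bar> ^ 0"
    by eventually_elim simp
qed

lemma O_power_imp_tendsto:
  assumes "is_O_power (Suc q) f"
  shows "(f \<longlongrightarrow> 0) (at 0)"
proof -
  obtain C where C: "\<forall>\<^sub>F \<epsilon> in at 0. norm (f \<epsilon>) \<le> C * \<bar>\<epsilon>\<bar> ^ Suc q"
    using assms unfolding is_O_power_iff by blast
  have "((\<lambda>\<epsilon>. C * \<bar>\<epsilon>\<bar> ^ Suc q) \<longlongrightarrow> C * \<bar>0\<bar> ^ Suc q) (at 0)"
    by (intro tendsto_intros)
  then show ?thesis
    by (intro Lim_null_comparison[OF C]) simp
qed

text \<open>
  The \<open>p\<close>-jet of \<open>f\<close> at \<open>0\<close> is the list of its first \<open>p + 1\<close> Taylor coefficients.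
  Only closeness to the Taylor polynomial at \<open>0\<close> is demanded, so that jets can be read off from
  approximate equations.
\<close>

definition has_jet :: "nat \<Rightarrow> (real \<Rightarrow> 'b::real_normed_vector) \<Rightarrow> (nat \<Rightarrow> 'b) \<Rightarrow> bool" where
  "has_jet p f a \<longleftrightarrow> is_O_power (Suc p) (\<lambda>\<epsilon>. f \<epsilon> - (\<Sum>j\<le>p. \<epsilon> ^ j *\<^sub>R a j))"

text \<open>
  A polynomial of degree at most \<open>p\<close> cannot be small of order \<open>p + 1\<close>: the limit at \<open>0\<close>
  gives \<open>d 0 = 0\<close>, and one may divide by \<open>\<epsilon>\<close> and repeat. This is what makes jets comparable.
\<close>

lemma O_power_polynomial_imp_zero:
  assumes "is_O_power (Suc p) (\<lambda>\<epsilon>. \<Sum>j\<le>p. \<epsilon> ^ j *\<^sub>R d j)" "j \<le> p"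
  shows "d j = 0"
  using assms
proof (induction p arbitrary: d j)
  case 0
  then have "((\<lambda>\<epsilon>::real. d 0) \<longlongrightarrow> 0) (at 0)"
    using O_power_imp_tendsto[OF 0(1)] by simp
  then have "d 0 = 0"
    by (simp add: tendsto_const_iff)
  then show ?case using 0 by simp
next
  case (Suc p)
  let ?f = "\<lambda>\<epsilon>::real. \<Sum>j\<le>Suc p. \<epsilon> ^ j *\<^sub>R d j"
  have split: "?f \<epsilon> = d 0 + \<epsilon> *\<^sub>R (\<Sum>j\<le>p. \<epsilon> ^ j *\<^sub>R d (Suc j))" for \<epsilon>
    unfolding sum.atMost_Suc_shift by (simp add: scaleR_sum_right)
  have lim0: "(?f \<longlongrightarrow> 0) (at 0)"
    using Suc.prems(1) by (rule O_power_imp_tendsto)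
  have limd: "(?f \<longlongrightarrow> d 0) (at 0)"
  proof -
    have "((\<lambda>\<epsilon>. d 0 + \<epsilon> *\<^sub>R (\<Sum>j\<le>p. \<epsilon> ^ j *\<^sub>R d (Suc j))) \<longlongrightarrow>
        d 0 + 0 *\<^sub>R (\<Sum>j\<le>p. 0 ^ j *\<^sub>R d (Suc j))) (at 0)"
      by (intro tendsto_intros)
    then show ?thesis unfolding split by simp
  qed
  have d0: "d 0 = 0"
    by (rule LIM_unique[OF limd lim0])
  obtain C where C: "\<forall>\<^sub>F \<epsilon> in at 0. norm (?f \<epsilon>) \<le> C * \<bar>\<epsilon>\<bar> ^ Suc (Suc p)"
    using Suc.prems unfolding is_O_power_iff by blast
  have "\<forall>\<^sub>F \<epsilon> in at (0::real). \<epsilon> \<noteq> 0"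
    by (simp add: eventually_at_filter)
  with C have "\<forall>\<^sub>F \<epsilon> in at 0. norm (\<Sum>j\<le>p. \<epsilon> ^ j *\<^sub>R d (Suc j)) \<le> C * \<bar>\<epsilon>\<bar> ^ Suc p"
  proof eventually_elim
    case (elim \<epsilon>)
    then have "\<bar>\<epsilon>\<bar> * norm (\<Sum>j\<le>p. \<epsilon> ^ j *\<^sub>R d (Suc j)) \<le> \<bar>\<epsilon>\<bar> * (C * \<bar>\<epsilon>\<bar> ^ Suc p)"
      unfolding split d0 by (simp add: mult_ac)
    then show ?case
      by (rule mult_left_le_imp_le) (use elim(2) in simp)
  qed
  then have "is_O_power (Suc p) (\<lambda>\<epsilon>. \<Sum>j\<le>p. \<epsilon> ^ j *\<^sub>R d (Suc j))"
    by (rule O_powerI)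
  from Suc.IH[OF this] d0 Suc.prems(2) show ?case
    by (cases j) auto
qed

lemma has_jet_unique:
  assumes "has_jet p f a" "has_jet p f b" "j \<le> p"
  shows "a j = b j"
proof -
  have "is_O_power (Suc p) (\<lambda>\<epsilon>. \<Sum>j\<le>p. \<epsilon> ^ j *\<^sub>R (b j - a j))"
    using O_power_diff[OF assms(1,2)[unfolded has_jet_def]]
    by (simp add: scaleR_diff_right sum_subtractf algebra_simps)
  from O_power_polynomial_imp_zero[OF this assms(3)] show ?thesis by simp
qed

lemma has_jet_cong:
  assumes "\<forall>\<^sub>F \<epsilon> in at 0. f \<epsilon> = g \<epsilon>" "\<And>j. j \<le> p \<Longrightarrow> a j = b j" "has_jet p f a"
  shows "has_jet p g b"
proof -
  have "(\<Sum>j\<le>p. \<epsilon> ^ j *\<^sub>R a j) = (\<Sum>j\<le>p. \<epsilon> ^ j *\<^sub>R b j)" for \<epsilon> :: real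
    using assms(2) by (intro sum.cong) auto
  with assms show ?thesis
    unfolding has_jet_def by (auto elim!: O_power_cong[rotated] eventually_mono)
qed

lemma has_jet_perturb:
  assumes "has_jet p f a" "is_O_power (Suc p) (\<lambda>\<epsilon>. g \<epsilon> - f \<epsilon>)"
  shows "has_jet p g a"
  using O_power_add[OF assms(2) assms(1)[unfolded has_jet_def]] unfolding has_jet_def by simp

lemma has_jet_scaleR: "has_jet p f a \<Longrightarrow> has_jet p (\<lambda>\<epsilon>. c *\<^sub>R f \<epsilon>) (\<lambda>j. c *\<^sub>R a j)"
  unfolding has_jet_def
  by (drule O_power_scaleR[of _ _ c]) (simp add: scaleR_diff_right scaleR_sum_right mult.commute)

lemma has_jet_sum:
  assumes "\<And>i. i \<in> I \<Longrightarrow> has_jet p (f i) (a i)"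
  shows "has_jet p (\<lambda>\<epsilon>. \<Sum>i\<in>I. f i \<epsilon>) (\<lambda>j. \<Sum>i\<in>I. a i j)"
proof -
  have "is_O_power (Suc p) (\<lambda>\<epsilon>. \<Sum>i\<in>I. f i \<epsilon> - (\<Sum>j\<le>p. \<epsilon> ^ j *\<^sub>R a i j))"
    using assms unfolding has_jet_def by (rule O_power_sum)
  moreover have "(\<Sum>i\<in>I. f i \<epsilon> - (\<Sum>j\<le>p. \<epsilon> ^ j *\<^sub>R a i j))
      = (\<Sum>i\<in>I. f i \<epsilon>) - (\<Sum>j\<le>p. \<epsilon> ^ j *\<^sub>R (\<Sum>i\<in>I. a i j))" for \<epsilon>
    by (simp add: sum_subtractf scaleR_sum_right sum.swap[of _ I])
  ultimately show ?thesis unfolding has_jet_def by simp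
qed

lemma has_jet_polynomial: "has_jet p (\<lambda>\<epsilon>. \<Sum>j\<le>p. \<epsilon> ^ j *\<^sub>R a j) a"
  unfolding has_jet_def by (simp add: O_power_zero)

lemma has_jet_const: "has_jet p (\<lambda>\<epsilon>. c) (\<lambda>j. if j = 0 then c else 0)"
proof -
  have "(\<Sum>j\<le>p. \<epsilon> ^ j *\<^sub>R (if j = 0 then c else 0)) = c" for \<epsilon> :: real
    by (subst sum.remove[of _ 0]) (auto intro!: sum.neutral)
  then show ?thesis
    using has_jet_polynomial[of p "\<lambda>j. if j = 0 then c else 0"] by simp
qed

lemma O_power_monomial: "q \<le> i \<Longrightarrow> is_O_power q (\<lambda>\<epsilon>. \<epsilon> ^ i *\<^sub>R c)"
  using O_power_mono[OF O_power_power_scaleR[OF O_power_tendsto[OF tendsto_const[of c]]], of q i] by simp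

text \<open>
  Multiplication by \<open>\<epsilon>\<^sup>i\<close> shifts the coefficients; those shifted beyond position \<open>p\<close>
  are absorbed by the error term.
\<close>

lemma has_jet_power_scaleR:
  assumes "has_jet p f a"
  shows "has_jet p (\<lambda>\<epsilon>. \<epsilon> ^ i *\<^sub>R f \<epsilon>) (\<lambda>j. if i \<le> j then a (j - i) else 0)"
proof -
  have 1: "is_O_power (Suc p) (\<lambda>\<epsilon>. \<epsilon> ^ i *\<^sub>R f \<epsilon> - (\<Sum>j\<le>p. \<epsilon> ^ (i + j) *\<^sub>R a j))"
    using O_power_mono[OF O_power_power_scaleR[OF assms[unfolded has_jet_def], of i], of "Suc p"]
    by (simp add: scaleR_diff_right scaleR_sum_right power_add)
  \<comment> \<open>The terms that are shifted beyond position \<open>p\<close>.\<close>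
  have 2: "is_O_power (Suc p) (\<lambda>\<epsilon>. \<Sum>j\<in>{j. j \<le> p \<and> p < i + j}. \<epsilon> ^ (i + j) *\<^sub>R a j)"
    by (intro O_power_sum O_power_monomial) auto
  have fin: "finite {j. i + j \<le> p}"
    by (rule finite_subset[of _ "{..p}"]) auto
  have 3: "(\<Sum>j\<le>p. \<epsilon> ^ (i + j) *\<^sub>R a j) = (\<Sum>j\<in>{j. j \<le> p \<and> p < i + j}. \<epsilon> ^ (i + j) *\<^sub>R a j)
      + (\<Sum>j\<le>p. \<epsilon> ^ j *\<^sub>R (if i \<le> j then a (j - i) else 0))" for \<epsilon> :: real
  proof -
    have "(\<Sum>j\<le>p. \<epsilon> ^ (i + j) *\<^sub>R a j) = (\<Sum>j\<in>{j. j \<le> p \<and> p < i + j}. \<epsilon> ^ (i + j) *\<^sub>R a j)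
        + (\<Sum>j\<in>{j. i + j \<le> p}. \<epsilon> ^ (i + j) *\<^sub>R a j)"
      by (subst sum.union_disjoint[symmetric]) (auto intro!: sum.cong fin)
    also have "(\<Sum>j\<in>{j. i + j \<le> p}. \<epsilon> ^ (i + j) *\<^sub>R a j) = (\<Sum>j\<in>{i..p}. \<epsilon> ^ j *\<^sub>R a (j - i))"
      by (rule sum.reindex_bij_witness[of _ "\<lambda>j. j - i" "\<lambda>j. i + j"]) auto
    also have "\<dots> = (\<Sum>j\<le>p. \<epsilon> ^ j *\<^sub>R (if i \<le> j then a (j - i) else 0))"
      by (rule sum.mono_neutral_cong_left) auto
    finally show ?thesis .
  qed
  show ?thesis
    using O_power_add[OF 1 2] unfolding has_jet_def 3 by simp
qed

lemma has_jet_tendsto: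
  assumes "has_jet p f a"
  shows "(f \<longlongrightarrow> a 0) (at 0)"
proof -
  have "((\<lambda>\<epsilon>. (f \<epsilon> - (\<Sum>j\<le>p. \<epsilon> ^ j *\<^sub>R a j)) + (\<Sum>j\<le>p. \<epsilon> ^ j *\<^sub>R a j)) \<longlongrightarrow>
      0 + (\<Sum>j\<le>p. 0 ^ j *\<^sub>R a j)) (at 0)"
    using O_power_imp_tendsto[OF assms[unfolded has_jet_def]] by (intro tendsto_intros)
  moreover have "(\<Sum>j\<le>p. 0 ^ j *\<^sub>R a j) = a 0"
    by (subst sum.remove[of _ 0]) (auto intro!: sum.neutral simp: power_0_left)
  ultimately show ?thesis by simp
qed

text \<open>
  One step of the expansion of a composition: the base point \<open>P \<epsilon>\<close> is kept and only the
  increment in direction \<open>y\<close> is Taylor expanded. The remainder is \<open>O(\<epsilon>\<^bsup>m(p+1)\<^esup>)\<close>, which is why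
  \<open>p + 1\<close> terms suffice for every \<open>m \<ge> 1\<close>. The jets of the derivatives along the path \<open>P\<close> are
  left to the next step.
\<close>

lemma has_jet_directional:
  assumes S: "open S" "Cinf_on G S" "z \<in> S" and m: "m \<ge> 1"
    and P: "(P \<longlongrightarrow> z) (at 0)"
    and jets: "\<And>c. c \<le> p \<Longrightarrow> has_jet p (\<lambda>\<epsilon>. nth_frechet G (P \<epsilon>) (replicate c y)) (A c)"
  shows "has_jet p (\<lambda>\<epsilon>. G (P \<epsilon> + (\<epsilon> ^ m * a) *\<^sub>R y))
    (\<lambda>j. \<Sum>c\<le>p. (a ^ c / fact c) *\<^sub>R (if m * c \<le> j then A c (j - m * c) else 0))"
proof (rule has_jet_perturb)
  show "has_jet p (\<lambda>\<epsilon>. \<Sum>c\<le>p. (a ^ c / fact c) *\<^sub>R \<epsilon> ^ (m * c) *\<^sub>R nth_frechet G (P \<epsilon>) (replicate c y))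
    (\<lambda>j. \<Sum>c\<le>p. (a ^ c / fact c) *\<^sub>R (if m * c \<le> j then A c (j - m * c) else 0))"
    using jets by (intro has_jet_sum has_jet_scaleR has_jet_power_scaleR) auto
  obtain r where r: "r > 0" "cball z r \<subseteq> S"
    using S open_contains_cball by blast
  let ?h = "\<lambda>x. nth_frechet G x (replicate (Suc p) y)"
  have "continuous_on (cball z r) ?h"
    by (rule continuous_on_subset[OF _ r(2)], rule Ck_on_imp_continuous_on[OF Cinf_on_nth_frechet[OF S(2), THEN spec]])
  then have "bounded (?h ` cball z r)"
    by (intro compact_imp_bounded compact_continuous_image compact_cball)
  then obtain B where B: "\<forall>x\<in>cball z r. norm (?h x) \<le> B"
    unfolding bounded_iff by auto
  have "((\<lambda>\<epsilon>. norm (P \<epsilon> - z) + \<bar>\<epsilon> ^ m * a\<bar> * norm y) \<longlongrightarrow> norm (z - z) + \<bar>0 ^ m * a\<bar> * norm y) (at 0)"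
    by (intro tendsto_intros P)
  then have "\<forall>\<^sub>F \<epsilon> in at 0. norm (P \<epsilon> - z) + \<bar>\<epsilon> ^ m * a\<bar> * norm y < r"
    using m r(1) by (intro order_tendstoD(2)) (auto simp: power_0_left)
  then have "\<forall>\<^sub>F \<epsilon> in at 0. norm (G (P \<epsilon> + (\<epsilon> ^ m * a) *\<^sub>R y) -
      (\<Sum>c\<le>p. (a ^ c / fact c) *\<^sub>R \<epsilon> ^ (m * c) *\<^sub>R nth_frechet G (P \<epsilon>) (replicate c y)))
      \<le> (B * \<bar>a\<bar> ^ Suc p) * \<bar>\<epsilon>\<bar> ^ (m * Suc p)"
  proof eventually_elim
    case (elim \<epsilon>)
    have "norm (G (P \<epsilon> + (\<epsilon> ^ m * a) *\<^sub>R y) -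
        (\<Sum>c\<le>p. ((\<epsilon> ^ m * a) ^ c / fact c) *\<^sub>R nth_frechet G (P \<epsilon>) (replicate c y)))
        \<le> B * \<bar>\<epsilon> ^ m * a\<bar> ^ Suc p"
      using elim B by (intro directional_Taylor_bound[OF S(1,2) r(2)]) auto
    moreover have "(\<epsilon> ^ m * a) ^ c / fact c = a ^ c / fact c * \<epsilon> ^ (m * c)" for c
      by (simp add: power_mult_distrib power_mult)
    moreover have "\<bar>\<epsilon> ^ m * a\<bar> ^ Suc p = \<bar>a\<bar> ^ Suc p * \<bar>\<epsilon>\<bar> ^ (m * Suc p)"
      by (simp only: abs_mult power_mult_distrib power_abs power_mult mult.commute)
    ultimately show ?case
      by (simp only: scaleR_scaleR mult.assoc)
  qed
  then have "is_O_power (m * Suc p) (\<lambda>\<epsilon>. G (P \<epsilon> + (\<epsilon> ^ m * a) *\<^sub>R y) -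
      (\<Sum>c\<le>p. (a ^ c / fact c) *\<^sub>R \<epsilon> ^ (m * c) *\<^sub>R nth_frechet G (P \<epsilon>) (replicate c y)))"
    by (rule O_powerI)
  then show "is_O_power (Suc p) (\<lambda>\<epsilon>. G (P \<epsilon> + (\<epsilon> ^ m * a) *\<^sub>R y) -
      (\<Sum>c\<le>p. (a ^ c / fact c) *\<^sub>R \<epsilon> ^ (m * c) *\<^sub>R nth_frechet G (P \<epsilon>) (replicate c y)))"
    by (rule O_power_mono) (use mult_le_mono1[OF m, of "Suc p"] in simp)
qed

section \<open>Jets of compositions and Bell polynomials\<close>

text \<open>
  The exponents \<open>b\<close> of the monomials of weight \<open>j\<close> in \<open>w 1, \<dots>, w N\<close>, when \<open>w l\<close> has weight \<open>l\<close>.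
\<close>

definition weight_indices :: "nat \<Rightarrow> nat \<Rightarrow> (nat \<Rightarrow> nat) set" where
  "weight_indices N j = {b. (\<forall>l. l \<notin> {1..N} \<longrightarrow> b l = 0) \<and> (\<Sum>l=1..N. l * b l) = j}"

text \<open>
  The coefficient of \<open>\<epsilon>\<^sup>j\<close> in \<open>G (z + (\<Sum>l=1..N. (\<epsilon> ^ l / fact l) *\<^sub>R w l))\<close>; see
  \<open>has_jet_taylor_coeff\<close>.
\<close>

definition taylor_coeff ::
  "('a::real_normed_vector \<Rightarrow> 'b::real_normed_vector) \<Rightarrow> 'a \<Rightarrow> nat \<Rightarrow> (nat \<Rightarrow> 'a) \<Rightarrow> nat \<Rightarrow> 'b" where
  "taylor_coeff G z N w j = (\<Sum>b\<in>weight_indices N j.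
     (\<Prod>l=1..N. (1 / fact l) ^ b l / fact (b l)) *\<^sub>R
       nth_frechet G z (concat (map (\<lambda>l. replicate (b l) (w l)) [1..<N + 1])))"

lemma finite_weight_indices: "finite (weight_indices N j)"
proof (rule finite_subset)
  show "weight_indices N j \<subseteq> {b. \<forall>l. (l \<in> {1..N} \<longrightarrow> b l \<in> {..j}) \<and> (l \<notin> {1..N} \<longrightarrow> b l = 0)}"
  proof (safe)
    fix b l assume b: "b \<in> weight_indices N j" and l: "l \<in> {1..N}"
    have "b l \<le> l * b l" using l by simp
    also have "\<dots> \<le> (\<Sum>l=1..N. l * b l)"
      using l by (intro member_le_sum) auto
    finally show "b l \<le> j" using b by (simp add: weight_indices_def)
  qed (auto simp: weight_indices_def)
  show "finite {b. \<forall>l. (l \<in> {1..N} \<longrightarrow> b l \<in> {..j}) \<and> (l \<notin> {1..N} \<longrightarrow> b l = (0::nat))}"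
    by (intro finite_set_of_finite_funs) auto
qed

lemma weight_indices_0: "weight_indices 0 j = (if j = 0 then {\<lambda>_. 0} else {})"
  by (auto simp: weight_indices_def)

text \<open>
  The last exponent \<open>c = b (Suc N)\<close> is summed last, as it belongs to the direction that is expanded
  first; the others share the remaining weight.
\<close>

lemma sum_weight_indices_Suc:
  "(\<Sum>b\<in>weight_indices (Suc N) j. h b)
     = (\<Sum>c\<in>{c. Suc N * c \<le> j}. \<Sum>b\<in>weight_indices N (j - Suc N * c). h (b(Suc N := c)))"
proof -
  have fin: "finite {c. Suc N * c \<le> j}"
    by (rule finite_subset[of _ "{..j}"]) auto
  have upd: "(\<Sum>l=1..N. l * (b(Suc N := c)) l) = (\<Sum>l=1..N. l * b l)" for b :: "nat \<Rightarrow> nat" and c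
    by (intro sum.cong) auto
  have "(\<Sum>c\<in>{c. Suc N * c \<le> j}. \<Sum>b\<in>weight_indices N (j - Suc N * c). h (b(Suc N := c)))
      = (\<Sum>(c, b)\<in>Sigma {c. Suc N * c \<le> j} (\<lambda>c. weight_indices N (j - Suc N * c)). h (b(Suc N := c)))"
    using fin finite_weight_indices by (intro sum.Sigma) auto
  also have "\<dots> = (\<Sum>b\<in>weight_indices (Suc N) j. h b)"
  proof (rule sum.reindex_bij_witness[of _ "\<lambda>b. (b (Suc N), b(Suc N := 0))" "\<lambda>(c, b). b(Suc N := c)"])
    fix x assume x: "x \<in> Sigma {c. Suc N * c \<le> j} (\<lambda>c. weight_indices N (j - Suc N * c))"
    obtain c b where [simp]: "x = (c, b)" by (cases x)
    have b: "Suc N * c \<le> j" "\<And>l. l \<notin> {1..N} \<Longrightarrow> b l = 0" "(\<Sum>l=1..N. l * b l) = j - Suc N * c"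
      using x by (auto simp: weight_indices_def)
    have "b (Suc N) = 0" using b(2) by auto
    then show "(\<lambda>b. (b (Suc N), b(Suc N := 0))) ((\<lambda>(c, b). b(Suc N := c)) x) = x"
      by (auto simp: fun_eq_iff)
    have "(\<Sum>l=1..Suc N. l * (b(Suc N := c)) l) = j"
      using b(1) upd[of b c] b(3) by (simp add: sum.cl_ivl_Suc del: mult_Suc)
    then show "(\<lambda>(c, b). b(Suc N := c)) x \<in> weight_indices (Suc N) j"
      using b(2) by (auto simp: weight_indices_def simp del: sum.cl_ivl_Suc)
  next
    fix b assume "b \<in> weight_indices (Suc N) j"
    then have b: "\<And>l. l \<notin> {1..Suc N} \<Longrightarrow> b l = 0" "(\<Sum>l=1..N. l * b l) + Suc N * b (Suc N) = j"
      by (auto simp: weight_indices_def)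
    have "(\<Sum>l=1..N. l * (b(Suc N := 0)) l) = j - Suc N * b (Suc N)"
      unfolding upd using b(2) by linarith
    moreover have "\<forall>l. l \<notin> {1..N} \<longrightarrow> (b(Suc N := 0)) l = 0"
      using b(1) by (auto simp: le_Suc_eq)
    ultimately show "(b (Suc N), b(Suc N := 0)) \<in> Sigma {c. Suc N * c \<le> j} (\<lambda>c. weight_indices N (j - Suc N * c))"
      using b(2) by (simp add: weight_indices_def del: fun_upd_apply)
  qed (auto simp: fun_eq_iff)
  finally show ?thesis by simp
qed

text \<open>
  The last direction is differentiated innermost, hence the derivatives along \<open>w (Suc N)\<close> form
  the function whose coefficients with respect to \<open>w 1, \<dots>, w N\<close> are taken. This is the shape in which
  \<open>has_jet_directional\<close> produces the coefficients.
\<close>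

lemma taylor_coeff_Suc:
  "taylor_coeff G z (Suc N) w j = (\<Sum>c\<in>{c. Suc N * c \<le> j}.
     ((1 / fact (Suc N)) ^ c / fact c) *\<^sub>R
       taylor_coeff (\<lambda>x. nth_frechet G x (replicate c (w (Suc N)))) z N w (j - Suc N * c))"
proof -
  have prod: "(\<Prod>l=1..Suc N. (1 / fact l) ^ (b(Suc N := c)) l / fact ((b(Suc N := c)) l))
      = (1 / fact (Suc N)) ^ c / fact c * (\<Prod>l=1..N. (1 / fact l) ^ b l / (fact (b l) :: real))" for b c
  proof -
    have "(\<Prod>l=1..N. (1 / fact l) ^ (b(Suc N := c)) l / fact ((b(Suc N := c)) l))
        = (\<Prod>l=1..N. (1 / fact l) ^ b l / (fact (b l) :: real))"
      by (intro prod.cong) auto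
    then show ?thesis
      by (simp add: mult.commute del: fact_Suc)
  qed
  have list: "concat (map (\<lambda>l. replicate ((b(Suc N := c)) l) (w l)) [1..<Suc N + 1])
      = concat (map (\<lambda>l. replicate (b l) (w l)) [1..<N + 1]) @ replicate c (w (Suc N))" for b c
  proof -
    have "map (\<lambda>l. replicate ((b(Suc N := c)) l) (w l)) [1..<N + 1] = map (\<lambda>l. replicate (b l) (w l)) [1..<N + 1]"
      by (intro map_cong) auto
    then have "concat (map (\<lambda>l. replicate ((b(Suc N := c)) l) (w l)) [1..<N + 1])
        = concat (map (\<lambda>l. replicate (b l) (w l)) [1..<N + 1])"
      by (rule arg_cong)
    moreover have "[1..<Suc N + 1] = [1..<N + 1] @ [Suc N]" by simp
    ultimately show ?thesis
      by (simp only: map_append concat_append list.map concat.simps append_Nil2 fun_upd_same)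
  qed
  show ?thesis
    unfolding taylor_coeff_def sum_weight_indices_Suc prod list nth_frechet_append[symmetric]
      scaleR_sum_right scaleR_scaleR by (rule refl)
qed

lemma has_jet_taylor_coeff:
  assumes "open S" "Cinf_on G S" "z \<in> S"
  shows "has_jet p (\<lambda>\<epsilon>. G (z + (\<Sum>l=1..N. (\<epsilon> ^ l / fact l) *\<^sub>R w l))) (taylor_coeff G z N w)"
  using assms(2)
proof (induction N arbitrary: G)
  case 0
  show ?case
    by (rule has_jet_cong[OF _ _ has_jet_const]) (auto simp: taylor_coeff_def weight_indices_0)
next
  case (Suc N)
  let ?P = "\<lambda>\<epsilon>::real. z + (\<Sum>l=1..N. (\<epsilon> ^ l / fact l) *\<^sub>R w l)"
  let ?A = "\<lambda>c. taylor_coeff (\<lambda>x. nth_frechet G x (replicate c (w (Suc N)))) z N w"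
  have "(?P \<longlongrightarrow> z + (\<Sum>l=1..N. (0 ^ l / fact l) *\<^sub>R w l)) (at 0)"
    by (intro tendsto_intros) auto
  then have P: "(?P \<longlongrightarrow> z) (at 0)"
    by (simp add: power_0_left)
  have jet: "has_jet p (\<lambda>\<epsilon>. G (?P \<epsilon> + (\<epsilon> ^ Suc N * (1 / fact (Suc N))) *\<^sub>R w (Suc N)))
    (\<lambda>j. \<Sum>c\<le>p. ((1 / fact (Suc N)) ^ c / fact c) *\<^sub>R (if Suc N * c \<le> j then ?A c (j - Suc N * c) else 0))"
    by (rule has_jet_directional[OF assms(1) Suc.prems assms(3) _ P])
      (use Suc.IH[OF Cinf_on_nth_frechet[OF Suc.prems]] in auto)
  have coeff: "(\<Sum>c\<le>p. ((1 / fact (Suc N)) ^ c / fact c) *\<^sub>R (if Suc N * c \<le> j then ?A c (j - Suc N * c) else 0))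
      = taylor_coeff G z (Suc N) w j" if "j \<le> p" for j
    unfolding taylor_coeff_Suc
  proof (rule sum.mono_neutral_cong_right)
    have "c \<le> p" if "Suc N * c \<le> j" for c
    proof -
      have "c \<le> Suc N * c" by simp
      with that \<open>j \<le> p\<close> show ?thesis by linarith
    qed
    then show "{c. Suc N * c \<le> j} \<subseteq> {..p}" by blast
  qed auto
  show ?case
    by (rule has_jet_cong[OF _ coeff jet]) (auto simp: add.assoc simp del: fact_Suc power_Suc)
qed

text \<open>
  The Bell exponents are listed up to \<open>j - m + 1\<close> only, while the expansion uses all directions up
  to \<open>N\<close>. The additional exponents vanish automatically.
\<close>

lemma bell_indices_eq:
  assumes "1 \<le> m" "m \<le> j" "j \<le> N"
  shows "bell_indices j m = {b \<in> weight_indices N j. (\<Sum>l=1..N. b l) = m}"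
proof -
  have sub: "{1..j - m + 1} \<subseteq> {1..N}" using assms by auto
  have restrict: "(\<Sum>l=1..N. f l * b l) = (\<Sum>l=1..j - m + 1. f l * b l)"
    if "\<forall>l. l \<notin> {1..j - m + 1} \<longrightarrow> b l = 0" for f b :: "nat \<Rightarrow> nat"
    using that sub by (intro sum.mono_neutral_right) auto
  show ?thesis
  proof (intro set_eqI iffI)
    fix b assume "b \<in> bell_indices j m"
    then have supp: "\<forall>l. l \<notin> {1..j - m + 1} \<longrightarrow> b l = 0"
      and j: "(\<Sum>l=1..j - m + 1. l * b l) = j" and m: "(\<Sum>l=1..j - m + 1. b l) = m"
      unfolding bell_indices_def by blast+
    have "\<forall>l. l \<notin> {1..N} \<longrightarrow> b l = 0"
      using supp sub by blast
    moreover have "(\<Sum>l=1..N. l * b l) = j"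
      using restrict[OF supp, of "\<lambda>l. l"] j by simp
    moreover have "(\<Sum>l=1..N. b l) = m"
      using restrict[OF supp, of "\<lambda>l. 1"] m by simp
    ultimately show "b \<in> {b \<in> weight_indices N j. (\<Sum>l=1..N. b l) = m}"
      unfolding weight_indices_def by blast
  next
    fix b assume b: "b \<in> {b \<in> weight_indices N j. (\<Sum>l=1..N. b l) = m}"
    \<comment> \<open>If \<open>b l > 0\<close>, one factor has weight \<open>l\<close> and each of the other \<open>m - 1\<close> has weight at least 1, so \<open>l + m - 1 \<le> j\<close>.\<close>
    have supp: "\<forall>l. l \<notin> {1..j - m + 1} \<longrightarrow> b l = 0"
    proof (intro allI impI, rule ccontr)
      fix l assume l: "l \<notin> {1..j - m + 1}" "b l \<noteq> 0"
      then have lN: "l \<in> {1..N}" using b by (auto simp: weight_indices_def)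
      have "l * b l + (\<Sum>i\<in>{1..N} - {l}. i * b i) = j" "b l + (\<Sum>i\<in>{1..N} - {l}. b i) = m"
        using b lN sum.remove[of "{1..N}" l "\<lambda>i. i * b i"] sum.remove[of "{1..N}" l b]
        by (auto simp: weight_indices_def)
      moreover have "(\<Sum>i\<in>{1..N} - {l}. b i) \<le> (\<Sum>i\<in>{1..N} - {l}. i * b i)"
        by (intro sum_mono) auto
      moreover have "l + b l \<le> l * b l + 1"
        using l lN by (cases "b l"; cases l) auto
      ultimately have "l + m \<le> j + 1" by linarith
      with l lN show False by auto
    qed
    have "(\<Sum>l=1..j - m + 1. l * b l) = j"
      using restrict[OF supp, of "\<lambda>l. l"] b unfolding weight_indices_def by simp
    moreover have "(\<Sum>l=1..j - m + 1. b l) = m"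
      using restrict[OF supp, of "\<lambda>l. 1"] b by simp
    ultimately show "b \<in> bell_indices j m"
      using supp unfolding bell_indices_def by blast
  qed
qed

lemma bell_apply_eq:
  assumes "1 \<le> m" "m \<le> j" "j \<le> N"
  shows "(1 / fact j) *\<^sub>R bell_apply (nth_frechet G z) j m w
    = (\<Sum>b\<in>{b \<in> weight_indices N j. (\<Sum>l=1..N. b l) = m}.
        (\<Prod>l=1..N. (1 / fact l) ^ b l / fact (b l)) *\<^sub>R
          nth_frechet G z (concat (map (\<lambda>l. replicate (b l) (w l)) [1..<N + 1])))"
  unfolding bell_apply_def scaleR_sum_right bell_indices_eq[OF assms, symmetric]
proof (rule sum.cong[OF refl])
  fix b assume "b \<in> bell_indices j m"
  then have supp: "\<And>l. l \<notin> {1..j - m + 1} \<Longrightarrow> b l = 0"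
    by (auto simp: bell_indices_def)
  have "(\<Prod>l=1..N. (1 / fact l) ^ b l / (fact (b l) :: real)) = (\<Prod>l=1..j - m + 1. (1 / fact l) ^ b l / fact (b l))"
    using supp assms by (intro prod.mono_neutral_right) auto
  also have "\<dots> = 1 / (\<Prod>l=1..j - m + 1. fact (b l)) * (\<Prod>l=1..j - m + 1. (1 / fact l) ^ b l)"
    by (simp add: prod_dividef)
  finally have "1 / fact j * (fact j / (\<Prod>l=1..j - m + 1. fact (b l)) * (\<Prod>l=1..j - m + 1. (1 / fact l) ^ b l))
      = (\<Prod>l=1..N. (1 / fact l) ^ b l / (fact (b l) :: real))"
    by simp
  moreover have "concat (map (\<lambda>l. replicate (b l) (w l)) [1..<N + 1])
      = concat (map (\<lambda>l. replicate (b l) (w l)) [1..<j - m + 2])"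
  proof -
    have "[1..<N + 1] = [1..<j - m + 2] @ [j - m + 2..<N + 1]"
      using upt_add_eq_append[of 1 "j - m + 2" "N - (j - m + 1)"] assms by simp
    moreover have "concat (map (\<lambda>l. replicate (b l) (w l)) [j - m + 2..<N + 1]) = []"
      using supp by auto
    ultimately show ?thesis by simp
  qed
  ultimately show "(1 / fact j) *\<^sub>R (fact j / (\<Prod>l=1..j - m + 1. fact (b l)) * (\<Prod>l=1..j - m + 1. (1 / fact l) ^ b l)) *\<^sub>R
      nth_frechet G z (concat (map (\<lambda>l. replicate (b l) (w l)) [1..<j - m + 2]))
    = (\<Prod>l=1..N. (1 / fact l) ^ b l / fact (b l)) *\<^sub>R
      nth_frechet G z (concat (map (\<lambda>l. replicate (b l) (w l)) [1..<N + 1]))"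
    by (simp only: scaleR_scaleR)
qed

lemma taylor_coeff_eq_bell_sum:
  assumes "1 \<le> j" "j \<le> N"
  shows "taylor_coeff G z N w j = (\<Sum>m=1..j. (1 / fact j) *\<^sub>R bell_apply (nth_frechet G z) j m w)"
proof -
  have "(\<lambda>b. \<Sum>l=1..N. b l) ` weight_indices N j \<subseteq> {1..j}"
  proof safe
    fix b assume "b \<in> weight_indices N j"
    then have b: "(\<Sum>l=1..N. l * b l) = j" by (simp add: weight_indices_def)
    have "(\<Sum>l=1..N. b l) \<le> (\<Sum>l=1..N. l * b l)" by (intro sum_mono) auto
    moreover have "1 \<le> (\<Sum>l=1..N. b l)"
    proof (rule ccontr)
      assume "\<not> 1 \<le> (\<Sum>l=1..N. b l)"
      then have "(\<Sum>l=1..N. b l) = 0" by linarith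
      then have "(\<Sum>l=1..N. l * b l) = 0" by simp
      then show False using b assms(1) by simp
    qed
    ultimately show "(\<Sum>l=1..N. b l) \<in> {1..j}"
      unfolding b atLeastAtMost_iff by blast
  qed
  from sum.group[OF finite_weight_indices finite_atLeastAtMost this, symmetric]
  show ?thesis
    unfolding taylor_coeff_def using assms by (auto simp: bell_apply_eq intro!: sum.cong)
qed

text \<open>
  The formula of Faa di Bruno. The path agrees with the polynomial of \<open>has_jet_taylor_coeff\<close> up
  to \<open>O(\<epsilon>\<^bsup>k+1\<^esup>)\<close>, and the local Lipschitz property of \<open>G\<close> transfers this error to the values of \<open>G\<close>.
\<close>

lemma has_jet_compose:
  fixes G :: "'a::euclidean_space \<Rightarrow> 'b::euclidean_space"
  assumes S: "open S" "Cinf_on G S" "z \<in> S"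
    and P: "has_jet k P a" "a 0 = z" "\<And>l. l \<in> {1..k} \<Longrightarrow> a l = (1 / fact l) *\<^sub>R y l"
  shows "has_jet k (\<lambda>\<epsilon>. G (P \<epsilon>))
    (\<lambda>j. if j = 0 then G z else \<Sum>m=1..j. (1 / fact j) *\<^sub>R bell_apply (nth_frechet G z) j m y)"
proof -
  let ?Q = "\<lambda>\<epsilon>::real. z + (\<Sum>l=1..k. (\<epsilon> ^ l / fact l) *\<^sub>R y l)"
  have Q: "(\<Sum>j\<le>k. \<epsilon> ^ j *\<^sub>R a j) = ?Q \<epsilon>" for \<epsilon>
  proof -
    have "(\<Sum>j\<le>k. \<epsilon> ^ j *\<^sub>R a j) = a 0 + (\<Sum>j=1..k. \<epsilon> ^ j *\<^sub>R a j)"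
      by (simp add: atMost_atLeast0 sum.atLeast_Suc_atMost)
    with P(2,3) show ?thesis by simp
  qed
  have diff: "is_O_power (Suc k) (\<lambda>\<epsilon>. P \<epsilon> - ?Q \<epsilon>)"
    using P(1) unfolding has_jet_def Q .
  have "has_jet k ?Q a"
    using has_jet_polynomial[of k a] unfolding Q .
  then have lim: "(?Q \<longlongrightarrow> z) (at 0)" "(P \<longlongrightarrow> z) (at 0)"
    using has_jet_tendsto P(1,2) by blast+
  obtain C r where r: "r > 0" "cball z r \<subseteq> S"
    and L: "\<And>x y. x \<in> cball z r \<Longrightarrow> y \<in> cball z r \<Longrightarrow> norm (G x - G y) \<le> C * norm (x - y)"
    by (rule Cinf_on_locally_Lipschitz[OF S]) (rule that)
  have "\<forall>\<^sub>F \<epsilon> in at 0. dist (?Q \<epsilon>) z < r" "\<forall>\<^sub>F \<epsilon> in at 0. dist (P \<epsilon>) z < r"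
    using lim r(1) by (auto dest: tendstoD)
  then have "\<forall>\<^sub>F \<epsilon> in at 0. norm (G (P \<epsilon>) - G (?Q \<epsilon>)) \<le> C * norm (P \<epsilon> - ?Q \<epsilon>)"
    by eventually_elim (auto intro!: L simp: dist_commute)
  then have "is_O_power (Suc k) (\<lambda>\<epsilon>. G (P \<epsilon>) - G (?Q \<epsilon>))"
    by (rule O_power_dominated[OF diff])
  then have "has_jet k (\<lambda>\<epsilon>. G (P \<epsilon>)) (taylor_coeff G z k y)"
    by (rule has_jet_perturb[OF has_jet_taylor_coeff[OF S]])
  moreover have "taylor_coeff G z k y j
    = (if j = 0 then G z else \<Sum>m=1..j. (1 / fact j) *\<^sub>R bell_apply (nth_frechet G z) j m y)" if "j \<le> k" for j
  proof (cases "j = 0")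
    case True
    have "weight_indices k 0 = {\<lambda>_. 0}"
      by (force simp: weight_indices_def)
    then have "taylor_coeff G z k y 0 = G z"
      by (simp add: taylor_coeff_def concat_eq_Nil_conv[THEN iffD2])
    with True show ?thesis by simp
  qed (use taylor_coeff_eq_bell_sum[of j k] that in simp)
  ultimately show ?thesis
    by (auto intro: has_jet_cong[rotated 2])
qed

text \<open>
  The coefficients found here are the integrands of both recursions, divided by \<open>fact i\<close>: for the
  fields \<open>g i\<close> this is the recursion of \<^const>\<open>averaged_y\<close>, for the fields \<open>F i t\<close> with \<open>t\<close> fixed that of
  \<^const>\<open>melnikov_y\<close>.
\<close>

lemma has_jet_vector_field:
  fixes G :: "nat \<Rightarrow> 'a::euclidean_space \<Rightarrow> 'a"
  assumes S: "open S" "\<And>i. i \<in> {1..k} \<Longrightarrow> Cinf_on (G i) S" "z \<in> S"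
    and P: "has_jet k P a" "a 0 = z" "\<And>l. l \<in> {1..k} \<Longrightarrow> a l = (1 / fact l) *\<^sub>R y l"
  shows "has_jet k (\<lambda>\<epsilon>. \<Sum>i=1..k. \<epsilon> ^ i *\<^sub>R G i (P \<epsilon>))
    (\<lambda>i. if i = 0 then 0 else G i z +
      (\<Sum>j=1..i - 1. \<Sum>m=1..j. (1 / fact j) *\<^sub>R bell_apply (nth_frechet (G (i - j)) z) j m y))"
proof -
  let ?B = "\<lambda>i j. if j = 0 then G i z else \<Sum>m=1..j. (1 / fact j) *\<^sub>R bell_apply (nth_frechet (G i) z) j m y"
  have jet: "has_jet k (\<lambda>\<epsilon>. \<Sum>i=1..k. \<epsilon> ^ i *\<^sub>R G i (P \<epsilon>)) (\<lambda>j. \<Sum>i=1..k. if i \<le> j then ?B i (j - i) else 0)"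
    by (intro has_jet_sum has_jet_power_scaleR has_jet_compose[OF S(1) S(2) S(3) P]) auto
  have "(\<Sum>i=1..k. if i \<le> n then ?B i (n - i) else 0)
      = (if n = 0 then 0 else G n z +
      (\<Sum>j=1..n - 1. \<Sum>m=1..j. (1 / fact j) *\<^sub>R bell_apply (nth_frechet (G (n - j)) z) j m y))" if n: "n \<le> k" for n
  proof (cases "n = 0")
    case False
    have "(\<Sum>i=1..k. if i \<le> n then ?B i (n - i) else 0) = (\<Sum>i=1..n. ?B i (n - i))"
      using n by (intro sum.mono_neutral_cong_right) auto
    also have "\<dots> = (\<Sum>j=0..n - 1. ?B (n - j) j)"
      by (rule sum.reindex_bij_witness[of _ "\<lambda>j. n - j" "\<lambda>i. n - i"]) (use False in auto)
    also have "\<dots> = ?B n 0 + (\<Sum>j=1..n - 1. ?B (n - j) j)"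
      by (subst sum.atLeast_Suc_atMost) auto
    also have "(\<Sum>j=1..n - 1. ?B (n - j) j)
        = (\<Sum>j=1..n - 1. \<Sum>m=1..j. (1 / fact j) *\<^sub>R bell_apply (nth_frechet (G (n - j)) z) j m y)"
      by (intro sum.cong) auto
    finally show ?thesis using False by simp
  qed (auto intro!: sum.neutral)
  then show ?thesis
    by (rule has_jet_cong[OF _ _ jet, rotated]) auto
qed

section \<open>Mixed derivatives and jets depending on time\<close>

lemma has_jet_line:
  assumes "open S" "Cinf_on G S" "z \<in> S"
  shows "has_jet p (\<lambda>\<epsilon>. G (z + \<epsilon> *\<^sub>R v)) (\<lambda>j. (1 / fact j) *\<^sub>R nth_frechet G z (replicate j v))"
proof -
  have "has_jet p (\<lambda>\<epsilon>. G (z + (\<epsilon> ^ 1 * 1) *\<^sub>R v)) (\<lambda>j. \<Sum>c\<le>p. (1 ^ c / fact c) *\<^sub>R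
      (if 1 * c \<le> j then if j - 1 * c = 0 then nth_frechet G z (replicate c v) else 0 else 0))"
    by (rule has_jet_directional[OF assms _ tendsto_const has_jet_const]) simp
  then have jet: "has_jet p (\<lambda>\<epsilon>. G (z + \<epsilon> *\<^sub>R v)) (\<lambda>j. \<Sum>c\<le>p. (1 ^ c / fact c) *\<^sub>R
      (if 1 * c \<le> j then if j - 1 * c = 0 then nth_frechet G z (replicate c v) else 0 else 0))"
    by simp
  have "(\<Sum>c\<le>p. (1 ^ c / fact c) *\<^sub>R
      (if 1 * c \<le> j then if j - 1 * c = 0 then nth_frechet G z (replicate c v) else 0 else 0))
      = (1 / fact j) *\<^sub>R nth_frechet G z (replicate j v)" if "j \<le> p" for j
    using that by (subst sum.remove[of _ j]) (auto intro!: sum.neutral split: if_splits)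
  then show ?thesis
    by (rule has_jet_cong[OF _ _ jet, rotated]) auto
qed

text \<open>
  The value \<open>G (z + \<epsilon> *\<^sub>R u + \<epsilon> *\<^sub>R v)\<close> can be expanded in \<open>v\<close> first or in \<open>u\<close> first. The two
  second-order coefficients differ only in the order of the mixed derivative, and jets are unique.
\<close>

lemma second_frechet_symmetric:
  assumes "open S" "Cinf_on G S" "z \<in> S"
  shows "nth_frechet G z [u, v] = nth_frechet G z [v, u]"
proof -
  have jet: "has_jet 2 (\<lambda>\<epsilon>. G ((z + \<epsilon> *\<^sub>R u) + (\<epsilon> ^ 1 * 1) *\<^sub>R v)) (\<lambda>j. \<Sum>c\<le>2. (1 ^ c / fact c) *\<^sub>R
      (if 1 * c \<le> j then (1 / fact (j - 1 * c)) *\<^sub>R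
        nth_frechet (\<lambda>x. nth_frechet G x (replicate c v)) z (replicate (j - 1 * c) u) else 0))" for u v
  proof (rule has_jet_directional[OF assms])
    have "((\<lambda>\<epsilon>. z + \<epsilon> *\<^sub>R u) \<longlongrightarrow> z + 0 *\<^sub>R u) (at 0)"
      by (intro tendsto_intros)
    then show "((\<lambda>\<epsilon>. z + \<epsilon> *\<^sub>R u) \<longlongrightarrow> z) (at 0)" by simp
  qed (use has_jet_line[OF assms(1) Cinf_on_nth_frechet[OF assms(2)] assms(3)] in auto)
  have comm: "(\<lambda>\<epsilon>. G ((z + \<epsilon> *\<^sub>R u) + (\<epsilon> ^ 1 * 1) *\<^sub>R v)) = (\<lambda>\<epsilon>. G ((z + \<epsilon> *\<^sub>R v) + (\<epsilon> ^ 1 * 1) *\<^sub>R u))"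
    by (simp add: algebra_simps)
  show ?thesis
    using has_jet_unique[OF jet[of u v, unfolded comm] jet[of v u] order_refl]
    by (simp add: numeral_2_eq_2 nth_frechet_append del: nth_frechet.simps)
qed

lemma nth_frechet_swap:
  assumes "open S" "Cinf_on G S" "z \<in> S"
  shows "nth_frechet G z (u # v # vs) = nth_frechet G z (v # u # vs)"
  using second_frechet_symmetric[OF assms(1) Cinf_on_nth_frechet[OF assms(2), of vs] assms(3), of u v]
  by (simp add: nth_frechet_append del: nth_frechet.simps)

text \<open>
  The vector \<open>u\<close> moves to the front by adjacent swaps. A swap under outer derivatives is
  legitimate because it is an identity on the whole open set, which can be differentiated.
\<close>

lemma nth_frechet_replicate_snoc:
  assumes "open S" "Cinf_on G S" "z \<in> S"
  shows "nth_frechet G z (replicate j v @ [u]) = nth_frechet G z (u # replicate j v)"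
  using assms(3)
proof (induction j arbitrary: z)
  case (Suc j)
  have "frechet_derivative (\<lambda>x. nth_frechet G x (replicate j v @ [u])) (at z)
      = frechet_derivative (\<lambda>x. nth_frechet G x (u # replicate j v)) (at z)"
  proof (rule frechet_derivative_transform_within_open[OF _ assms(1) Suc.prems Suc.IH])
    show "(\<lambda>x. nth_frechet G x (replicate j v @ [u])) differentiable at z"
      using nth_frechet_has_derivative[OF assms(2) Suc.prems] unfolding differentiable_def by blast
  qed
  then have "nth_frechet G z (replicate (Suc j) v @ [u]) = nth_frechet G z (v # u # replicate j v)"
    by simp
  also have "\<dots> = nth_frechet G z (u # replicate (Suc j) v)"
    using nth_frechet_swap[OF assms(1,2) Suc.prems, of v u] by simp
  finally show ?case .
qed simp

definition jet_coeff :: "(real \<times> real \<Rightarrow> 'b::euclidean_space) \<Rightarrow> nat \<Rightarrow> real \<Rightarrow> 'b" where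
  "jet_coeff H j t = (1 / fact j) *\<^sub>R nth_frechet H (t, 0) (replicate j (0, 1))"

lemma has_jet_second_argument:
  assumes "open \<Omega>" "Cinf_on H \<Omega>" "(t, 0) \<in> \<Omega>"
  shows "has_jet p (\<lambda>\<epsilon>. H (t, \<epsilon>)) (\<lambda>j. jet_coeff H j t)"
  using has_jet_line[OF assms, of p "(0, 1)"] by (simp add: jet_coeff_def)

text \<open>
  The derivative in time of a Taylor coefficient applies \<open>(1, 0)\<close> after the derivatives in
  direction \<open>(0, 1)\<close>; by symmetry it may be applied before them.
\<close>

lemma jet_coeff_partial_derivative:
  assumes "open \<Omega>" "Cinf_on H \<Omega>" "(t, 0) \<in> \<Omega>"
  shows "(jet_coeff H j has_vector_derivative
    jet_coeff (\<lambda>p. frechet_derivative H (at p) (1, 0)) j t) (at t)"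
proof -
  have 1: "((\<lambda>t. (t, 0 :: real)) has_derivative (\<lambda>v. (v, 0))) (at t)"
    by (auto intro!: derivative_eq_intros)
  let ?vs = "replicate j (0 :: real, 1 :: real)"
  have lin: "linear (\<lambda>v. nth_frechet H (t, 0) (v # ?vs))"
    using has_derivative_linear[OF nth_frechet_has_derivative[OF assms(2,3)]] .
  have der: "((\<lambda>t. nth_frechet H (t, 0) ?vs) has_derivative (\<lambda>v. nth_frechet H (t, 0) ((v, 0) # ?vs))) (at t)"
    using has_derivative_compose[OF 1 nth_frechet_has_derivative[OF assms(2,3)]] .
  have scale: "nth_frechet H (t, 0) ((v, 0) # ?vs) = v *\<^sub>R nth_frechet H (t, 0) ((1, 0) # ?vs)" for v
    using linear_scale[OF lin, of v "(1, 0)"] by (simp del: nth_frechet.simps)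
  have "((\<lambda>t. nth_frechet H (t, 0) ?vs) has_vector_derivative nth_frechet H (t, 0) ((1, 0) # ?vs)) (at t)"
    unfolding has_vector_derivative_def
    by (rule has_derivative_eq_rhs[OF der]) (rule ext, rule scale)
  moreover have "nth_frechet H (t, 0) ((1, 0) # ?vs) = nth_frechet (\<lambda>p. frechet_derivative H (at p) (1, 0)) (t, 0) ?vs"
    using nth_frechet_replicate_snoc[OF assms, of j "(0, 1)" "(1, 0)"]
      nth_frechet_append[of H "[(1, 0)]" "(t, 0)" ?vs] by simp
  ultimately have "((\<lambda>t. nth_frechet H (t, 0) ?vs) has_vector_derivative
      nth_frechet (\<lambda>p. frechet_derivative H (at p) (1, 0)) (t, 0) ?vs) (at t)"
    by simp
  from has_vector_derivative_scaleR[OF DERIV_const this, of "1 / fact j"]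
  show ?thesis
    unfolding jet_coeff_def[abs_def] by simp
qed

lemma continuous_on_jet_coeff:
  assumes "Cinf_on H \<Omega>" "\<And>t. t \<in> A \<Longrightarrow> (t, 0) \<in> \<Omega>"
  shows "continuous_on A (jet_coeff H j)"
proof -
  have "continuous_on A (\<lambda>t. nth_frechet H (t, 0) (replicate j (0, 1)))"
    by (rule continuous_on_compose2[OF Ck_on_imp_continuous_on[OF Cinf_on_nth_frechet[OF assms(1), THEN spec]]])
      (use assms(2) in \<open>auto intro!: continuous_intros\<close>)
  then show ?thesis
    unfolding jet_coeff_def[abs_def] by (intro continuous_intros)
qed

section \<open>Vector-valued polynomials in time\<close>

definition poly_degree_le :: "nat \<Rightarrow> (real \<Rightarrow> 'a::real_vector) \<Rightarrow> bool" where
  "poly_degree_le N f \<longleftrightarrow> (\<exists>c. \<forall>t. f t = (\<Sum>l\<le>N. t ^ l *\<^sub>R c l))"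

lemma poly_degree_le_mono:
  assumes "poly_degree_le N f" "N \<le> M"
  shows "poly_degree_le M f"
proof -
  obtain c where c: "\<And>t. f t = (\<Sum>l\<le>N. t ^ l *\<^sub>R c l)"
    using assms(1) unfolding poly_degree_le_def by blast
  have "f t = (\<Sum>l\<le>M. t ^ l *\<^sub>R (if l \<le> N then c l else 0))" for t
    unfolding c using assms(2) by (intro sum.mono_neutral_cong_left) auto
  then show ?thesis unfolding poly_degree_le_def by (intro exI allI)
qed

lemma poly_degree_le_zero: "poly_degree_le N (\<lambda>_. 0)"
  unfolding poly_degree_le_def by (intro exI[of _ "\<lambda>_. 0"]) simp

lemma poly_degree_le_add:
  assumes "poly_degree_le N f" "poly_degree_le N g"
  shows "poly_degree_le N (\<lambda>t. f t + g t)"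
proof -
  obtain c d where "\<And>t. f t = (\<Sum>l\<le>N. t ^ l *\<^sub>R c l)" "\<And>t. g t = (\<Sum>l\<le>N. t ^ l *\<^sub>R d l)"
    using assms unfolding poly_degree_le_def by blast
  then have "f t + g t = (\<Sum>l\<le>N. t ^ l *\<^sub>R (c l + d l))" for t
    by (simp add: scaleR_add_right sum.distrib)
  then show ?thesis unfolding poly_degree_le_def by (intro exI allI)
qed

lemma poly_degree_le_scaleR:
  assumes "poly_degree_le N f"
  shows "poly_degree_le N (\<lambda>t. a *\<^sub>R f t)"
proof -
  obtain c where "\<And>t. f t = (\<Sum>l\<le>N. t ^ l *\<^sub>R c l)"
    using assms unfolding poly_degree_le_def by blast
  then have "a *\<^sub>R f t = (\<Sum>l\<le>N. t ^ l *\<^sub>R (a *\<^sub>R c l))" for t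
    by (simp add: scaleR_sum_right mult.commute)
  then show ?thesis unfolding poly_degree_le_def by (intro exI allI)
qed

lemma poly_degree_le_sum:
  "(\<And>i. i \<in> I \<Longrightarrow> poly_degree_le N (f i)) \<Longrightarrow> poly_degree_le N (\<lambda>t. \<Sum>i\<in>I. f i t)"
  by (induction I rule: infinite_finite_induct) (auto intro: poly_degree_le_zero poly_degree_le_add)

lemma poly_degree_le_power_scaleR:
  assumes "poly_degree_le N f"
  shows "poly_degree_le (i + N) (\<lambda>t. t ^ i *\<^sub>R f t)"
proof -
  obtain c where "\<And>t. f t = (\<Sum>l\<le>N. t ^ l *\<^sub>R c l)"
    using assms unfolding poly_degree_le_def by blast
  then have "t ^ i *\<^sub>R f t = (\<Sum>l\<le>N. t ^ (i + l) *\<^sub>R c l)" for t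
    by (simp add: scaleR_sum_right power_add)
  also have "(\<Sum>l\<le>N. t ^ (i + l) *\<^sub>R c l) = (\<Sum>l\<in>{i..i + N}. t ^ l *\<^sub>R c (l - i))" for t
    by (rule sum.reindex_bij_witness[of _ "\<lambda>l. l - i" "\<lambda>l. i + l"]) auto
  also have "(\<Sum>l\<in>{i..i + N}. t ^ l *\<^sub>R c (l - i)) = (\<Sum>l\<le>i + N. t ^ l *\<^sub>R (if i \<le> l then c (l - i) else 0))" for t
    by (intro sum.mono_neutral_cong_left) auto
  finally show ?thesis unfolding poly_degree_le_def by (intro exI allI)
qed

lemma poly_degree_le_integral:
  fixes f :: "real \<Rightarrow> 'a::euclidean_space"
  assumes "poly_degree_le N f"
  shows "poly_degree_le (Suc N) (\<lambda>t. LBINT s=0..t. f s)"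
    and "((\<lambda>t. LBINT s=0..t. f s) has_vector_derivative f t) (at t)"
proof -
  obtain c where c: "\<And>t. f t = (\<Sum>l\<le>N. t ^ l *\<^sub>R c l)"
    using assms unfolding poly_degree_le_def by blast
  define P where "P = (\<lambda>t. \<Sum>l\<le>N. (t ^ Suc l / real (Suc l)) *\<^sub>R c l)"
  have pow: "((\<lambda>t. t ^ Suc l / real (Suc l)) has_real_derivative t ^ l) (at t)" for l t
  proof -
    have "((\<lambda>t. t ^ Suc l / real (Suc l)) has_real_derivative real (Suc l) * t ^ l / real (Suc l)) (at t)"
      using DERIV_pow[of "Suc l" t] by (intro DERIV_cdivide) simp
    then show ?thesis by (simp del: of_nat_Suc)
  qed
  have P': "(P has_vector_derivative f t) (at t)" for t
  proof -
    have "((\<lambda>t. (t ^ Suc l / real (Suc l)) *\<^sub>R c l) has_vector_derivative t ^ l *\<^sub>R c l) (at t)" for l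
      using has_vector_derivative_scaleR[OF pow has_vector_derivative_const[of "c l"], of l t]
      by (simp del: power_Suc of_nat_Suc)
    then show ?thesis
      unfolding P_def c by (rule has_vector_derivative_sum)
  qed
  have cont: "continuous_on A f" for A
    unfolding c[abs_def] by (intro continuous_intros)
  have int: "(LBINT s=0..t. f s) = P t" for t
  proof -
    have "(LBINT s=ereal 0..ereal t. f s) = P t - P 0"
      by (rule interval_integral_FTC_finite[OF cont]) (rule has_vector_derivative_at_within[OF P'])
    then show ?thesis by (simp add: P_def zero_ereal_def)
  qed
  show "((\<lambda>t. LBINT s=0..t. f s) has_vector_derivative f t) (at t)"
    unfolding int by (rule P')
  have "P t = t ^ 1 *\<^sub>R (\<Sum>l\<le>N. t ^ l *\<^sub>R ((1 / real (Suc l)) *\<^sub>R c l))" for t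
    unfolding P_def by (simp add: scaleR_sum_right del: of_nat_Suc)
  moreover have "poly_degree_le (1 + N) (\<lambda>t. t ^ 1 *\<^sub>R (\<Sum>l\<le>N. t ^ l *\<^sub>R ((1 / real (Suc l)) *\<^sub>R c l)))"
    by (rule poly_degree_le_power_scaleR) (unfold poly_degree_le_def, rule exI[of _ "\<lambda>l. (1 / real (Suc l)) *\<^sub>R c l"], simp)
  ultimately show "poly_degree_le (Suc N) (\<lambda>t. LBINT s=0..t. f s)"
    unfolding int by simp
qed

text \<open>
  The arguments are indexed by their degrees, so that the sum of the indices bounds the degree
  of the result. The fixed arguments \<open>as\<close> collect the coefficients that the induction has already pulled
  out.
\<close>

lemma poly_degree_le_nth_frechet:
  assumes "open S" "Cinf_on G S" "z \<in> S"
    and "\<And>l. l \<in> set ls \<Longrightarrow> poly_degree_le l (y l)"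
  shows "poly_degree_le (sum_list ls) (\<lambda>s. nth_frechet G z (as @ map (\<lambda>l. y l s) ls))"
  using assms(4)
proof (induction ls arbitrary: as)
  case Nil
  then show ?case
    by (auto simp: poly_degree_le_def)
next
  case (Cons l ls)
  obtain c where c: "\<And>s. y l s = (\<Sum>i\<le>l. s ^ i *\<^sub>R c i)"
    using Cons.prems[of l] unfolding poly_degree_le_def by auto
  have "nth_frechet G z (as @ map (\<lambda>l. y l s) (l # ls))
      = (\<Sum>i\<le>l. s ^ i *\<^sub>R nth_frechet G z ((as @ [c i]) @ map (\<lambda>l. y l s) ls))" for s
    by (simp add: c linear_sum[OF linear_nth_frechet[OF assms(1-3)]] linear_scale[OF linear_nth_frechet[OF assms(1-3)]])
  moreover have "poly_degree_le (sum_list (l # ls)) (\<lambda>s. \<Sum>i\<le>l. s ^ i *\<^sub>R nth_frechet G z ((as @ [c i]) @ map (\<lambda>l. y l s) ls))"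
  proof (rule poly_degree_le_sum)
    fix i assume "i \<in> {..l}"
    then show "poly_degree_le (sum_list (l # ls)) (\<lambda>s. s ^ i *\<^sub>R nth_frechet G z ((as @ [c i]) @ map (\<lambda>l. y l s) ls))"
      using poly_degree_le_power_scaleR[OF Cons.IH[of "as @ [c i]"], of i] Cons.prems
      by (auto elim!: poly_degree_le_mono)
  qed
  ultimately show ?case by simp
qed

lemma poly_degree_le_bell_apply:
  assumes "open S" "Cinf_on G S" "z \<in> S" "1 \<le> m" "m \<le> j"
    and "\<And>l. l \<in> {1..j} \<Longrightarrow> poly_degree_le l (y l)"
  shows "poly_degree_le j (\<lambda>s. bell_apply (nth_frechet G z) j m (\<lambda>l. y l s))"
  unfolding bell_apply_def
proof (intro poly_degree_le_sum poly_degree_le_scaleR)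
  fix b assume b: "b \<in> bell_indices j m"
  let ?ls = "concat (map (\<lambda>l. replicate (b l) l) [1..<j - m + 2])"
  have sum_list_concat: "sum_list (concat xss) = sum_list (map sum_list xss)" for xss :: "nat list list"
    by (induction xss) auto
  have "sum_list ?ls = sum_list (map (\<lambda>l. l * b l) [1..<j - m + 2])"
    by (simp add: sum_list_concat o_def sum_list_replicate mult.commute)
  also have "\<dots> = (\<Sum>l=1..j - m + 1. l * b l)"
    by (subst interv_sum_list_conv_sum_set_nat) (auto intro!: sum.cong)
  also have "\<dots> = j" using b by (simp add: bell_indices_def)
  finally have deg: "sum_list ?ls = j" .
  have "poly_degree_le (sum_list ?ls) (\<lambda>s. nth_frechet G z ([] @ map (\<lambda>l. y l s) ?ls))"
    by (rule poly_degree_le_nth_frechet[OF assms(1-3)]) (use assms(4-6) in auto)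
  then show "poly_degree_le j (\<lambda>s. nth_frechet G z (concat (map (\<lambda>l. replicate (b l) (y l s)) [1..<j - m + 2])))"
    unfolding deg by (simp add: map_concat o_def)
qed

lemma Ck_on_polynomial:
  fixes h :: "'a::euclidean_space \<Rightarrow> real" and f :: "real \<Rightarrow> 'b::euclidean_space"
  assumes "open S" "Ck_on n h S" "poly_degree_le N f"
  shows "Ck_on n (\<lambda>x. f (h x)) S"
proof -
  obtain c where "\<And>t. f t = (\<Sum>l\<le>N. t ^ l *\<^sub>R c l)"
    using assms(3) unfolding poly_degree_le_def by blast
  then show ?thesis
    by (simp add: Ck_on_sum Ck_on_scaleR Ck_on_power Ck_on_const assms)
qed

section \<open>Melnikov functions and stroboscopic averages\<close>

lemma has_vector_derivative_chain:
  assumes "(c has_vector_derivative v) (at t)" "(f has_derivative f') (at (c t))"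
  shows "((\<lambda>\<tau>. f (c \<tau>)) has_vector_derivative f' v) (at t)"
  using vector_derivative_diff_chain_within[of c v t UNIV f f'] assms
    has_derivative_at_withinI[OF assms(2)]
  by (simp add: o_def)

text \<open>
  The recursion for \<^const>\<open>melnikov_y\<close> in differentiated form determines these functions, by
  induction on \<open>i\<close> and the fundamental theorem of calculus.
\<close>

lemma melnikov_y_unique:
  fixes F :: "nat \<Rightarrow> real \<Rightarrow> 'a::euclidean_space \<Rightarrow> 'a"
  assumes w: "\<And>i t. i \<in> {1..k} \<Longrightarrow> (w i has_vector_derivative w' i t) (at t)"
    and cont: "\<And>i. i \<in> {1..k} \<Longrightarrow> continuous_on UNIV (w' i)"
    and zero: "\<And>i. i \<in> {1..k} \<Longrightarrow> w i 0 = 0"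
    and w': "\<And>i t. i \<in> {1..k} \<Longrightarrow> w' i t = fact i *\<^sub>R (F i t z +
      (\<Sum>j=1..i - 1. \<Sum>m=1..j. (1 / fact j) *\<^sub>R bell_apply (nth_frechet (F (i - j) t) z) j m (\<lambda>l. w l t)))"
    and "i \<in> {1..k}"
  shows "melnikov_y F i t z = w i t"
  using assms(5)
proof (induction i arbitrary: t rule: less_induct)
  case (less i)
  have "fact i *\<^sub>R F i s z + (\<Sum>j=1..i - 1. \<Sum>m=1..j. (fact i / fact j) *\<^sub>R
      bell_apply (nth_frechet (F (i - j) s) z) j m (\<lambda>l. melnikov_y F l s z)) = w' i s" for s
  proof -
    have "bell_apply (nth_frechet (F (i - j) s) z) j m (\<lambda>l. melnikov_y F l s z)
        = bell_apply (nth_frechet (F (i - j) s) z) j m (\<lambda>l. w l s)" if "j \<in> {1..i - 1}" "m \<in> {1..j}" for j m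
      by (rule bell_apply_cong[OF refl refl refl], rule less.IH) (use that less.prems in auto)
    then show ?thesis
      unfolding w'[OF less.prems] scaleR_add_right scaleR_sum_right scaleR_scaleR by simp
  qed
  then have "melnikov_y F i t z = (LBINT s=0..t. w' i s)"
    by (subst melnikov_y.simps) simp
  also have "\<dots> = (LBINT s=ereal 0..ereal t. w' i s)"
    by (simp add: zero_ereal_def)
  also have "\<dots> = w i t - w i 0"
    by (rule interval_integral_FTC_finite[OF continuous_on_subset[OF cont[OF less.prems] subset_UNIV]])
      (rule has_vector_derivative_at_within[OF w[OF less.prems]])
  finally show ?case using zero[OF less.prems] by simp
qed

lemma averaged_y_polynomial:
  assumes "open D" "\<And>i. i \<in> {1..k} \<Longrightarrow> Cinf_on (g i) D" "z \<in> D" "i \<in> {1..k}"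
  shows "poly_degree_le i (\<lambda>t. averaged_y g i t z)"
  using assms(4)
proof (induction i rule: less_induct)
  case (less i)
  have "poly_degree_le i (\<lambda>t. (fact i * t) *\<^sub>R g i z)"
    unfolding poly_degree_le_def
    using less.prems
    by (intro exI[of _ "\<lambda>l. if l = 1 then fact i *\<^sub>R g i z else 0"]) (auto simp: if_distrib[of "\<lambda>x. _ *\<^sub>R x"] mult.commute cong: if_cong)
  moreover have "poly_degree_le i (\<lambda>t. LBINT s=0..t. bell_apply (nth_frechet (g (i - j)) z) j m (\<lambda>l. averaged_y g l s z))"
    if "j \<in> {1..i - 1}" "m \<in> {1..j}" for j m
  proof -
    have "Cinf_on (g (i - j)) D"
      using that less.prems by (intro assms(2)) auto
    then have "poly_degree_le (Suc j) (\<lambda>t. LBINT s=0..t. bell_apply (nth_frechet (g (i - j)) z) j m (\<lambda>l. averaged_y g l s z))"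
      using that less by (intro poly_degree_le_integral poly_degree_le_bell_apply[OF assms(1) _ assms(3)]) auto
    then show ?thesis
      by (rule poly_degree_le_mono) (use that in auto)
  qed
  ultimately show ?case
    by (subst averaged_y.simps) (intro poly_degree_le_add poly_degree_le_sum poly_degree_le_scaleR)
qed

lemma averaged_y_0: "averaged_y g i 0 z = 0"
  by (subst averaged_y.simps) (simp add: zero_ereal_def[symmetric])

lemma averaged_y_has_vector_derivative:
  assumes "open D" "\<And>i. i \<in> {1..k} \<Longrightarrow> Cinf_on (g i) D" "z \<in> D" "i \<in> {1..k}"
  shows "((\<lambda>t. averaged_y g i t z) has_vector_derivative fact i *\<^sub>R (g i z +
    (\<Sum>j=1..i - 1. \<Sum>m=1..j. (1 / fact j) *\<^sub>R
      bell_apply (nth_frechet (g (i - j)) z) j m (\<lambda>l. averaged_y g l t z)))) (at t)"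
proof -
  have "((\<lambda>t. LBINT s=0..t. bell_apply (nth_frechet (g (i - j)) z) j m (\<lambda>l. averaged_y g l s z))
      has_vector_derivative bell_apply (nth_frechet (g (i - j)) z) j m (\<lambda>l. averaged_y g l t z)) (at t)"
    if "j \<in> {1..i - 1}" "m \<in> {1..j}" for j m
  proof -
    have "Cinf_on (g (i - j)) D"
      using that assms(4) by (intro assms(2)) auto
    then have "poly_degree_le j (\<lambda>s. bell_apply (nth_frechet (g (i - j)) z) j m (\<lambda>l. averaged_y g l s z))"
      using that assms(4)
      by (intro poly_degree_le_bell_apply[OF assms(1) _ assms(3)] averaged_y_polynomial[OF assms(1,2,3)]) auto
    then show ?thesis by (rule poly_degree_le_integral(2))
  qed
  note int = this
  have lin: "((\<lambda>t. (fact i * t) *\<^sub>R g i z) has_vector_derivative fact i *\<^sub>R g i z) (at t)"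
    by (auto intro!: derivative_eq_intros has_vector_derivative_scaleR[THEN has_vector_derivative_eq_rhs])
  have summand: "((\<lambda>t. (fact i / fact j) *\<^sub>R (LBINT s=0..t. bell_apply (nth_frechet (g (i - j)) z) j m (\<lambda>l. averaged_y g l s z)))
      has_vector_derivative (fact i / fact j) *\<^sub>R bell_apply (nth_frechet (g (i - j)) z) j m (\<lambda>l. averaged_y g l t z)) (at t)"
    if "j \<in> {1..i - 1}" "m \<in> {1..j}" for j m
    by (rule has_vector_derivative_scaleR[OF DERIV_const int[OF that], THEN has_vector_derivative_eq_rhs]) simp
  have "((\<lambda>t. averaged_y g i t z) has_vector_derivative fact i *\<^sub>R g i z + (\<Sum>j=1..i - 1. \<Sum>m=1..j. (fact i / fact j) *\<^sub>R
      bell_apply (nth_frechet (g (i - j)) z) j m (\<lambda>l. averaged_y g l t z))) (at t)"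
    by (subst averaged_y.simps) (intro has_vector_derivative_add lin has_vector_derivative_sum summand)
  then show ?thesis
    unfolding scaleR_add_right scaleR_sum_right scaleR_scaleR by simp
qed

lemma eventually_abs_le_at_0: "0 < e \<Longrightarrow> \<forall>\<^sub>F \<epsilon> in at (0::real). \<bar>\<epsilon>\<bar> \<le> e"
  by (auto simp: eventually_at intro!: exI[of _ e])

lemma sum_power_0:
  fixes v :: "nat \<Rightarrow> 'a::real_vector"
  shows "(\<Sum>i=1..k. (0 ^ i / fact i :: real) *\<^sub>R v i) = 0"
  by (intro sum.neutral) (auto simp: power_0_left)

text \<open>
  The comparison of the two expansions at time \<open>T\<close>. The functions \<open>X\<close>, \<open>U\<close> and \<open>W\<close> in
  the proof are those of the introduction; they are considered as functions of all variables jointly, because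
  mixed derivatives are exchanged. The set \<open>\<Omega>\<close> of pairs \<open>(t, \<epsilon>)\<close> for which \<open>X\<close> stays in \<open>D\<close> is an
  open neighbourhood of the line \<open>\<epsilon> = 0\<close>.
\<close>

lemma melnikov_y_eq_averaged_y:
  fixes D :: "'a::euclidean_space set"
  assumes D: "open D" and \<epsilon>\<^sub>0: "\<epsilon>\<^sub>0 > 0"
    and F: "\<And>i. i \<in> {1..k} \<Longrightarrow> smooth_on (UNIV \<times> D) (\<lambda>(t, x). F i t x)"
    and R: "smooth_on (UNIV \<times> D \<times> {-\<epsilon>\<^sub>0..\<epsilon>\<^sub>0}) (\<lambda>(t, x, \<epsilon>). R t x \<epsilon>)"
    and strob: "stroboscopic_averaged k D T \<epsilon>\<^sub>0 F R g"
    and z: "z \<in> D" and i: "i \<in> {1..k}"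
  shows "melnikov_y F i T z = averaged_y g i T z"
proof -
  have g: "\<And>i. i \<in> {1..k} \<Longrightarrow> Cinf_on (g i) D"
    using smooth_on_open_imp_Ck_on[OF D bspec[OF strob[unfolded stroboscopic_averaged_def, THEN conjunct1]]]
    by blast
  obtain u r where
    ur: "(\<forall>i\<in>{1..k}. smooth_on (UNIV \<times> D) (\<lambda>(t, \<xi>). u i t \<xi>) \<and> (\<forall>t. \<forall>\<xi>\<in>D. u i (t + T) \<xi> = u i t \<xi>)) \<and>
        (\<forall>\<xi>\<in>D. \<forall>\<epsilon>\<in>{-\<epsilon>\<^sub>0..\<epsilon>\<^sub>0}. near_identity k u 0 \<xi> \<epsilon> = \<xi>) \<and>
        (\<forall>V. open V \<and> compact (closure V) \<and> closure V \<subseteq> D \<longrightarrow>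
          (\<exists>\<epsilon>\<^sub>V. 0 < \<epsilon>\<^sub>V \<and> \<epsilon>\<^sub>V \<le> \<epsilon>\<^sub>0 \<and>
             smooth_on (UNIV \<times> V \<times> {-\<epsilon>\<^sub>V..\<epsilon>\<^sub>V}) (\<lambda>(t, \<xi>, \<epsilon>). r t \<xi> \<epsilon>) \<and>
             (\<forall>t. \<forall>\<xi>\<in>V. \<forall>\<epsilon>\<in>{-\<epsilon>\<^sub>V..\<epsilon>\<^sub>V}.
                r (t + T) \<xi> \<epsilon> = r t \<xi> \<epsilon> \<and>
                near_identity k u t \<xi> \<epsilon> \<in> D \<and>
                vector_derivative (\<lambda>\<tau>. near_identity k u \<tau> \<xi> \<epsilon>) (at t) +
                frechet_derivative (\<lambda>x. near_identity k u t x \<epsilon>) (at \<xi>)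
                  ((\<Sum>i=1..k. \<epsilon> ^ i *\<^sub>R g i \<xi>) + \<epsilon> ^ (k + 1) *\<^sub>R r t \<xi> \<epsilon>) =
                (\<Sum>i=1..k. \<epsilon> ^ i *\<^sub>R F i t (near_identity k u t \<xi> \<epsilon>)) +
                \<epsilon> ^ (k + 1) *\<^sub>R R t (near_identity k u t \<xi> \<epsilon>) \<epsilon>)))"
    using strob[unfolded stroboscopic_averaged_def, THEN conjunct2] by (elim exE) (rule that)
  have u: "smooth_on (UNIV \<times> D) (\<lambda>(t, \<xi>). u i t \<xi>)"
    and u_periodic: "\<And>t \<xi>. \<xi> \<in> D \<Longrightarrow> u i (t + T) \<xi> = u i t \<xi>" if "i \<in> {1..k}" for i
    using ur[THEN conjunct1] that by auto
  have U_0: "near_identity k u 0 \<xi> \<epsilon> = \<xi>" if "\<xi> \<in> D" "\<bar>\<epsilon>\<bar> \<le> \<epsilon>\<^sub>0" for \<xi> \<epsilon>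
    using ur[THEN conjunct2, THEN conjunct1] that by (auto simp: abs_le_iff)
  have U_T: "near_identity k u T \<xi> \<epsilon> = near_identity k u 0 \<xi> \<epsilon>" if "\<xi> \<in> D" for \<xi> \<epsilon>
    using u_periodic[of _ \<xi> 0] that by (simp add: near_identity_def)
  \<comment> \<open>The transformed equation is available on relatively compact sets only; a ball around \<open>z\<close> contains \<open>X t \<epsilon>\<close> for small \<open>\<epsilon>\<close>.\<close>
  obtain \<rho> where \<rho>: "\<rho> > 0" "cball z \<rho> \<subseteq> D"
    using D z open_contains_cball by blast
  define V where "V = ball z \<rho>"
  have V: "open V" "compact (closure V)" "closure V \<subseteq> D" "V \<subseteq> D" "z \<in> V"
    using \<rho> by (auto simp: V_def)
  obtain e where e: "0 < e" "e \<le> \<epsilon>\<^sub>0"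
    and r: "smooth_on (UNIV \<times> V \<times> {-e..e}) (\<lambda>(t, \<xi>, \<epsilon>). r t \<xi> \<epsilon>)"
    and transformed: "\<forall>t. \<forall>\<xi>\<in>V. \<forall>\<epsilon>\<in>{-e..e}.
        r (t + T) \<xi> \<epsilon> = r t \<xi> \<epsilon> \<and>
        near_identity k u t \<xi> \<epsilon> \<in> D \<and>
        vector_derivative (\<lambda>\<tau>. near_identity k u \<tau> \<xi> \<epsilon>) (at t) +
        frechet_derivative (\<lambda>x. near_identity k u t x \<epsilon>) (at \<xi>)
          ((\<Sum>i=1..k. \<epsilon> ^ i *\<^sub>R g i \<xi>) + \<epsilon> ^ (k + 1) *\<^sub>R r t \<xi> \<epsilon>) =
        (\<Sum>i=1..k. \<epsilon> ^ i *\<^sub>R F i t (near_identity k u t \<xi> \<epsilon>)) +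
        \<epsilon> ^ (k + 1) *\<^sub>R R t (near_identity k u t \<xi> \<epsilon>) \<epsilon>"
    using ur[THEN conjunct2, THEN conjunct2, THEN spec, THEN mp, OF conjI[OF V(1) conjI[OF V(2,3)]]]
    by (elim exE conjE) (rule that)

  define y where "y = (\<lambda>i t. averaged_y g i t z)"
  define X where "X = (\<lambda>t \<epsilon>. z + (\<Sum>i=1..k. (\<epsilon> ^ i / fact i) *\<^sub>R y i t))"
  define U where "U = (\<lambda>p :: real \<times> 'a \<times> real. near_identity k u (fst p) (fst (snd p)) (snd (snd p)))"
  define \<Omega> where "\<Omega> = (\<lambda>p. X (fst p) (snd p)) -` D"
  define W where "W = (\<lambda>p. U (fst p, X (fst p) (snd p), snd p))"

  have DU_open: "open (UNIV \<times> D \<times> UNIV :: (real \<times> 'a \<times> real) set)"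
    using D by (intro open_Times) auto
  have CU: "Cinf_on U (UNIV \<times> D \<times> UNIV)"
  proof
    fix n
    let ?S = "UNIV \<times> D \<times> UNIV :: (real \<times> 'a \<times> real) set"
    have "Ck_on n (\<lambda>p. u i (fst p) (fst (snd p))) ?S" if "i \<in> {1..k}" for i
    proof -
      have "Ck_on n (\<lambda>(t, \<xi>). u i t \<xi>) (UNIV \<times> D)"
        by (rule smooth_on_open_imp_Ck_on[OF _ u[OF that]]) (intro open_Times open_UNIV D)
      moreover have "Ck_on n (\<lambda>p. (fst p, fst (snd p))) ?S"
        by (rule Ck_on_bounded_linear[OF DU_open bounded_linear_Pair[OF bounded_linear_fst
                bounded_linear_compose[OF bounded_linear_fst bounded_linear_snd]]])
      ultimately have "Ck_on n (\<lambda>p. (\<lambda>(t, \<xi>). u i t \<xi>) (fst p, fst (snd p))) ?S"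
        by (rule Ck_on_compose[OF open_Times[OF open_UNIV D] DU_open]) auto
      then show ?thesis by simp
    qed
    moreover have "Ck_on n (\<lambda>p. fst (snd p)) ?S" "Ck_on n (\<lambda>p. snd (snd p)) ?S"
      by (rule Ck_on_bounded_linear[OF DU_open bounded_linear_compose[OF bounded_linear_fst bounded_linear_snd]],
          rule Ck_on_bounded_linear[OF DU_open bounded_linear_compose[OF bounded_linear_snd bounded_linear_snd]])
    ultimately show "Ck_on n U ?S"
      unfolding U_def near_identity_def
      by (intro Ck_on_add Ck_on_sum Ck_on_scaleR Ck_on_power DU_open)
  qed
  have CX: "Cinf_on (\<lambda>p. X (fst p) (snd p)) UNIV"
  proof
    fix n
    have "Ck_on n (\<lambda>p :: real \<times> real. (snd p ^ i / fact i) *\<^sub>R y i (fst p)) UNIV" if "i \<in> {1..k}" for i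
    proof -
      have "Ck_on n (\<lambda>p :: real \<times> real. (1 / fact i) *\<^sub>R (snd p ^ i *\<^sub>R y i (fst p))) UNIV"
        unfolding y_def
        by (intro Ck_on_scaleR Ck_on_const Ck_on_power Ck_on_bounded_linear bounded_linear_snd open_UNIV
            Ck_on_polynomial[OF _ _ averaged_y_polynomial[where g = g, OF D g z that]] bounded_linear_fst)
      then show ?thesis by simp
    qed
    then show "Ck_on n (\<lambda>p. X (fst p) (snd p)) UNIV"
      unfolding X_def by (intro Ck_on_add Ck_on_sum Ck_on_const open_UNIV)
  qed
  have \<Omega>: "open \<Omega>"
    unfolding \<Omega>_def by (intro open_vimage D Ck_on_imp_continuous_on[OF CX[THEN spec]])
  have CW: "Cinf_on W \<Omega>"
  proof
    fix n
    have "Ck_on n (\<lambda>p. (fst p, X (fst p) (snd p), snd p)) \<Omega>"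
      by (intro Ck_on_Pair Ck_on_bounded_linear bounded_linear_fst bounded_linear_snd \<Omega>
          Ck_on_subset[OF CX[THEN spec]]) auto
    then show "Ck_on n W \<Omega>"
      unfolding W_def
      by (intro Ck_on_compose[OF DU_open \<Omega> CU[THEN spec]]) (auto simp: \<Omega>_def)
  qed
  have X_0: "X t 0 = z" for t
    unfolding X_def sum_power_0 by simp
  have \<Omega>_0: "(t, 0) \<in> \<Omega>" for t
    using z by (simp add: \<Omega>_def X_0)
  have W_0: "W (t, 0) = z" for t
    by (simp add: W_def U_def X_0 near_identity_def power_0_left)

  define a where "a = (\<lambda>i t. g i z + (\<Sum>j=1..i - 1. \<Sum>m=1..j. (1 / fact j) *\<^sub>R
      bell_apply (nth_frechet (g (i - j)) z) j m (\<lambda>l. y l t)))"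
  define X' where "X' = (\<lambda>t \<epsilon>. \<Sum>i=1..k. \<epsilon> ^ i *\<^sub>R a i t)"
  have X': "((\<lambda>\<tau>. X \<tau> \<epsilon>) has_vector_derivative X' t \<epsilon>) (at t)" for t \<epsilon>
  proof -
    have "((\<lambda>\<tau>. (\<epsilon> ^ i / fact i) *\<^sub>R y i \<tau>) has_vector_derivative \<epsilon> ^ i *\<^sub>R a i t) (at t)"
      if "i \<in> {1..k}" for i
      using has_vector_derivative_scaleR[OF DERIV_const[where k = "\<epsilon> ^ i / fact i"]
          averaged_y_has_vector_derivative[where g = g and t = t, OF D g z that]]
      by (simp add: y_def a_def)
    then have "((\<lambda>\<tau>. z + (\<Sum>i=1..k. (\<epsilon> ^ i / fact i) *\<^sub>R y i \<tau>)) has_vector_derivative 0 + X' t \<epsilon>) (at t)"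
      unfolding X'_def by (intro has_vector_derivative_add has_vector_derivative_const has_vector_derivative_sum)
    then show ?thesis by (simp add: X_def)
  qed
  have X_jet: "has_jet k (X t) (\<lambda>i. if i = 0 then z else (1 / fact i) *\<^sub>R y i t)" for t
  proof -
    have "(\<Sum>j\<le>k. \<epsilon> ^ j *\<^sub>R (if j = 0 then z else (1 / fact j) *\<^sub>R y j t)) = X t \<epsilon>" for \<epsilon>
      by (simp add: atMost_atLeast0 sum.atLeast_Suc_atMost X_def)
    then show ?thesis
      using has_jet_polynomial[of k "\<lambda>i. if i = 0 then z else (1 / fact i) *\<^sub>R y i t"] by simp
  qed
  have X_tendsto: "(X t \<longlongrightarrow> z) (at 0)" for t
    using has_jet_tendsto[OF X_jet[of t]] by simp
  \<comment> \<open>\<open>X\<close> solves the averaged equation up to \<open>O(\<epsilon>\<^bsup>k+1\<^esup>)\<close>: the coefficients \<open>a i t\<close> of \<open>X'\<close> are those of the right-hand side along \<open>X\<close>.\<close>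
  have X_remainder: "is_O_power (Suc k) (\<lambda>\<epsilon>. X' t \<epsilon> - (\<Sum>i=1..k. \<epsilon> ^ i *\<^sub>R g i (X t \<epsilon>)))" for t
  proof -
    have "has_jet k (\<lambda>\<epsilon>. \<Sum>i=1..k. \<epsilon> ^ i *\<^sub>R g i (X t \<epsilon>)) (\<lambda>i. if i = 0 then 0 else a i t)"
      unfolding a_def by (rule has_jet_vector_field[OF D g z X_jet]) auto
    moreover have "(\<Sum>j\<le>k. \<epsilon> ^ j *\<^sub>R (if j = 0 then 0 else a j t)) = X' t \<epsilon>" for \<epsilon>
      by (simp add: atMost_atLeast0 sum.atLeast_Suc_atMost X'_def)
    ultimately have "is_O_power (Suc k) (\<lambda>\<epsilon>. (\<Sum>i=1..k. \<epsilon> ^ i *\<^sub>R g i (X t \<epsilon>)) - X' t \<epsilon>)"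
      unfolding has_jet_def by simp
    then show ?thesis
      by (rule O_power_dominated[of _ _ _ 1]) (simp add: norm_minus_commute)
  qed
  have X_V: "\<forall>\<^sub>F \<epsilon> in at 0. X t \<epsilon> \<in> V" for t
    using topological_tendstoD[OF X_tendsto V(1,5)] .
  have W_jet: "has_jet k (\<lambda>\<epsilon>. W (t, \<epsilon>)) (\<lambda>j. jet_coeff W j t)" for t
    by (rule has_jet_second_argument[OF \<Omega> CW \<Omega>_0])
  have W_coeff_0: "jet_coeff W 0 t = z" for t
    by (simp add: jet_coeff_def W_0)
  have W_tendsto: "((\<lambda>\<epsilon>. W (t, \<epsilon>)) \<longlongrightarrow> z) (at 0)" for t
    using has_jet_tendsto[OF W_jet[of t]] by (simp add: W_coeff_0)

  define w where "w = (\<lambda>i t. fact i *\<^sub>R jet_coeff W i t)"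
  define W' where "W' = (\<lambda>p. frechet_derivative W (at p) (1, 0))"
  have CW': "Cinf_on W' \<Omega>"
    unfolding W'_def using CW by (metis Ck_on.simps(2))
  have W'_eq: "W' (t, \<epsilon>) = frechet_derivative U (at (t, X t \<epsilon>, \<epsilon>)) (1, X' t \<epsilon>, 0)"
    if "X t \<epsilon> \<in> D" for t \<epsilon>
  proof -
    have "(t, \<epsilon>) \<in> \<Omega>" using that by (simp add: \<Omega>_def)
    then have W_der: "(W has_derivative frechet_derivative W (at (t, \<epsilon>))) (at (t, \<epsilon>))"
      by (rule Ck_on_Suc_has_derivative[OF CW[THEN spec, of "Suc 0"]])
    have "((\<lambda>\<tau>. (\<tau>, \<epsilon>)) has_vector_derivative (1, 0)) (at t)"
      by (intro has_vector_derivative_Pair has_vector_derivative_id has_vector_derivative_const)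
    from has_vector_derivative_chain[where f = W, OF this W_der]
    have 1: "((\<lambda>\<tau>. W (\<tau>, \<epsilon>)) has_vector_derivative W' (t, \<epsilon>)) (at t)"
      unfolding W'_def .
    have U_der: "(U has_derivative frechet_derivative U (at (t, X t \<epsilon>, \<epsilon>))) (at (t, X t \<epsilon>, \<epsilon>))"
      by (rule Ck_on_Suc_has_derivative[OF CU[THEN spec, of "Suc 0"]]) (use that in simp)
    have "((\<lambda>\<tau>. (\<tau>, X \<tau> \<epsilon>, \<epsilon>)) has_vector_derivative (1, X' t \<epsilon>, 0)) (at t)"
      by (intro has_vector_derivative_Pair has_vector_derivative_id has_vector_derivative_const X')
    from has_vector_derivative_chain[where f = U, OF this U_der]
    have "((\<lambda>\<tau>. W (\<tau>, \<epsilon>)) has_vector_derivative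
        frechet_derivative U (at (t, X t \<epsilon>, \<epsilon>)) (1, X' t \<epsilon>, 0)) (at t)"
      by (simp add: W_def)
    with 1 show ?thesis by (rule vector_derivative_unique_at)
  qed
  have U_partials: "vector_derivative (\<lambda>\<tau>. near_identity k u \<tau> \<xi> \<epsilon>) (at t) = frechet_derivative U (at (t, \<xi>, \<epsilon>)) (1, 0, 0)"
    "frechet_derivative (\<lambda>x. near_identity k u t x \<epsilon>) (at \<xi>) v = frechet_derivative U (at (t, \<xi>, \<epsilon>)) (0, v, 0)"
    "linear (frechet_derivative U (at (t, \<xi>, \<epsilon>)))" if "\<xi> \<in> D" for t \<xi> \<epsilon> v
  proof -
    have U': "(U has_derivative frechet_derivative U (at (t, \<xi>, \<epsilon>))) (at (t, \<xi>, \<epsilon>))"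
      by (rule Ck_on_Suc_has_derivative[OF CU[THEN spec, of "Suc 0"]]) (use that in simp)
    then show "linear (frechet_derivative U (at (t, \<xi>, \<epsilon>)))"
      by (rule has_derivative_linear)
    have "((\<lambda>\<tau>. (\<tau>, \<xi>, \<epsilon>)) has_vector_derivative (1, 0, 0)) (at t)"
      by (intro has_vector_derivative_Pair has_vector_derivative_id has_vector_derivative_const)
    from has_vector_derivative_chain[OF this U']
    show "vector_derivative (\<lambda>\<tau>. near_identity k u \<tau> \<xi> \<epsilon>) (at t) = frechet_derivative U (at (t, \<xi>, \<epsilon>)) (1, 0, 0)"
      by (intro vector_derivative_at) (simp add: U_def)
    have "((\<lambda>x. (t, x, \<epsilon>)) has_derivative (\<lambda>v. (0, v, 0))) (at \<xi>)"
      by (auto intro!: derivative_eq_intros)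
    from frechet_derivative_at[OF has_derivative_compose[OF this U']]
    show "frechet_derivative (\<lambda>x. near_identity k u t x \<epsilon>) (at \<xi>) v = frechet_derivative U (at (t, \<xi>, \<epsilon>)) (0, v, 0)"
      by (simp add: U_def fun_eq_iff)
  qed
  \<comment> \<open>\<open>W\<close> solves the original equation up to \<open>O(\<epsilon>\<^bsup>k+1\<^esup>)\<close>: replacing \<open>X'\<close> by the averaged vector field costs \<open>?\<delta>\<close>, on which \<open>\<partial>\<^sub>\<xi> U\<close> acts boundedly.\<close>
  have W'_remainder: "is_O_power (Suc k) (\<lambda>\<epsilon>. W' (t, \<epsilon>) - (\<Sum>i=1..k. \<epsilon> ^ i *\<^sub>R F i t (W (t, \<epsilon>))))" for t
  proof -
    let ?\<delta> = "\<lambda>\<epsilon>. (X' t \<epsilon> - (\<Sum>i=1..k. \<epsilon> ^ i *\<^sub>R g i (X t \<epsilon>))) - \<epsilon> ^ (k + 1) *\<^sub>R r t (X t \<epsilon>) \<epsilon>"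
    have ev_e: "\<forall>\<^sub>F \<epsilon> in at 0. \<bar>\<epsilon>\<bar> \<le> e" using e(1) by (rule eventually_abs_le_at_0)
    have eq: "\<forall>\<^sub>F \<epsilon> in at 0. \<epsilon> ^ (k + 1) *\<^sub>R R t (W (t, \<epsilon>)) \<epsilon> +
        frechet_derivative U (at (t, X t \<epsilon>, \<epsilon>)) (0, ?\<delta> \<epsilon>, 0)
        = W' (t, \<epsilon>) - (\<Sum>i=1..k. \<epsilon> ^ i *\<^sub>R F i t (W (t, \<epsilon>)))"
      using ev_e X_V[of t]
    proof eventually_elim
      case (elim \<epsilon>)
      have XD: "X t \<epsilon> \<in> D" using elim(2) V(4) by auto
      let ?D = "frechet_derivative U (at (t, X t \<epsilon>, \<epsilon>))"
      note lin = U_partials(3)[OF XD, of t \<epsilon>]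
      have W: "near_identity k u t (X t \<epsilon>) \<epsilon> = W (t, \<epsilon>)"
        by (simp add: W_def U_def)
      have "?D (1, 0, 0) + ?D (0, (\<Sum>i=1..k. \<epsilon> ^ i *\<^sub>R g i (X t \<epsilon>)) + \<epsilon> ^ (k + 1) *\<^sub>R r t (X t \<epsilon>) \<epsilon>, 0)
          = (\<Sum>i=1..k. \<epsilon> ^ i *\<^sub>R F i t (W (t, \<epsilon>))) + \<epsilon> ^ (k + 1) *\<^sub>R R t (W (t, \<epsilon>)) \<epsilon>"
        using transformed[THEN spec, THEN bspec[OF _ elim(2)], THEN bspec, of \<epsilon> t] elim(1)
        unfolding U_partials(1,2)[OF XD] W by (simp add: abs_le_iff)
      moreover have "W' (t, \<epsilon>) = ?D (1, 0, 0)
          + ?D (0, (\<Sum>i=1..k. \<epsilon> ^ i *\<^sub>R g i (X t \<epsilon>)) + \<epsilon> ^ (k + 1) *\<^sub>R r t (X t \<epsilon>) \<epsilon>, 0) + ?D (0, ?\<delta> \<epsilon>, 0)"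
        unfolding W'_eq[OF XD] linear_add[OF lin, symmetric] by simp
      ultimately show ?case by simp
    qed
    have RW: "is_O_power (Suc k) (\<lambda>\<epsilon>. \<epsilon> ^ (k + 1) *\<^sub>R R t (W (t, \<epsilon>)) \<epsilon>)"
    proof -
      have "((\<lambda>\<epsilon>. (\<lambda>(t, x, \<epsilon>). R t x \<epsilon>) (t, W (t, \<epsilon>), \<epsilon>)) \<longlongrightarrow> (\<lambda>(t, x, \<epsilon>). R t x \<epsilon>) (t, z, 0)) (at 0)"
      proof (rule continuous_on_tendsto_compose[OF smooth_on_imp_continuous_on[OF R]])
        show "((\<lambda>\<epsilon>. (t, W (t, \<epsilon>), \<epsilon>)) \<longlongrightarrow> (t, z, 0)) (at 0)"
          by (intro tendsto_intros W_tendsto)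
        show "\<forall>\<^sub>F \<epsilon> in at 0. (t, W (t, \<epsilon>), \<epsilon>) \<in> UNIV \<times> D \<times> {-\<epsilon>\<^sub>0..\<epsilon>\<^sub>0}"
          using topological_tendstoD[OF W_tendsto D z] eventually_abs_le_at_0[OF \<epsilon>\<^sub>0]
          by eventually_elim (auto simp: abs_le_iff)
      qed (use z \<epsilon>\<^sub>0 in auto)
      from O_power_power_scaleR[OF O_power_tendsto[OF this], of "k + 1"] show ?thesis by simp
    qed
    have r_remainder: "is_O_power (Suc k) (\<lambda>\<epsilon>. \<epsilon> ^ (k + 1) *\<^sub>R r t (X t \<epsilon>) \<epsilon>)"
    proof -
      have "((\<lambda>\<epsilon>. (\<lambda>(t, x, \<epsilon>). r t x \<epsilon>) (t, X t \<epsilon>, \<epsilon>)) \<longlongrightarrow> (\<lambda>(t, x, \<epsilon>). r t x \<epsilon>) (t, z, 0)) (at 0)"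
      proof (rule continuous_on_tendsto_compose[OF smooth_on_imp_continuous_on[OF r]])
        show "((\<lambda>\<epsilon>. (t, X t \<epsilon>, \<epsilon>)) \<longlongrightarrow> (t, z, 0)) (at 0)"
          by (intro tendsto_intros X_tendsto)
        show "\<forall>\<^sub>F \<epsilon> in at 0. (t, X t \<epsilon>, \<epsilon>) \<in> UNIV \<times> V \<times> {-e..e}"
          using X_V[of t] ev_e by eventually_elim (auto simp: abs_le_iff)
      qed (use V(5) e in auto)
      from O_power_power_scaleR[OF O_power_tendsto[OF this], of "k + 1"] show ?thesis by simp
    qed
    have \<delta>: "is_O_power (Suc k) ?\<delta>"
      by (intro O_power_diff[OF X_remainder r_remainder])
    have "(t, z, 0) \<in> UNIV \<times> D \<times> UNIV" using z by simp
    then obtain C \<rho>' where C: "\<rho>' > 0"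
      "\<And>p v. p \<in> cball (t, z, 0) \<rho>' \<Longrightarrow> norm (frechet_derivative U (at p) v) \<le> C * norm v"
      by (rule Cinf_on_derivative_locally_bounded[OF DU_open CU]) (rule that)
    have "((\<lambda>\<epsilon>. (t, X t \<epsilon>, \<epsilon>)) \<longlongrightarrow> (t, z, 0)) (at 0)"
      by (intro tendsto_intros X_tendsto)
    from tendstoD[OF this C(1)]
    have "\<forall>\<^sub>F \<epsilon> in at 0. norm (frechet_derivative U (at (t, X t \<epsilon>, \<epsilon>)) (0, ?\<delta> \<epsilon>, 0)) \<le> C * norm (?\<delta> \<epsilon>)"
    proof eventually_elim
      case (elim \<epsilon>)
      then have "norm (frechet_derivative U (at (t, X t \<epsilon>, \<epsilon>)) (0, ?\<delta> \<epsilon>, 0)) \<le> C * norm (0 :: real, ?\<delta> \<epsilon>, 0 :: real)"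
        by (intro C(2)) (simp add: dist_commute)
      then show ?case by (simp add: norm_Pair)
    qed
    from O_power_add[OF RW O_power_dominated[OF \<delta> this]] show ?thesis
      by (rule O_power_cong[OF eq])
  qed
  have W'_jet: "jet_coeff W' i t = F i t z + (\<Sum>j=1..i - 1. \<Sum>m=1..j. (1 / fact j) *\<^sub>R
      bell_apply (nth_frechet (F (i - j) t) z) j m (\<lambda>l. w l t))" if i: "i \<in> {1..k}" for i t
  proof -
    have 1: "has_jet k (\<lambda>\<epsilon>. W' (t, \<epsilon>)) (\<lambda>j. jet_coeff W' j t)"
      by (rule has_jet_second_argument[OF \<Omega> CW' \<Omega>_0])
    have 2: "has_jet k (\<lambda>\<epsilon>. W' (t, \<epsilon>)) (\<lambda>i. if i = 0 then 0 else F i t z +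
        (\<Sum>j=1..i - 1. \<Sum>m=1..j. (1 / fact j) *\<^sub>R bell_apply (nth_frechet (F (i - j) t) z) j m (\<lambda>l. w l t)))"
      by (rule has_jet_perturb[OF has_jet_vector_field[OF D Cinf_on_slice[OF D F] z W_jet W_coeff_0] W'_remainder])
        (auto simp: w_def)
    from has_jet_unique[OF 1 2, of i] i show ?thesis by simp
  qed
  have "melnikov_y F i T z = w i T"
  proof (rule melnikov_y_unique[where k = k and w' = "\<lambda>i t. fact i *\<^sub>R jet_coeff W' i t"])
    fix i t assume i: "i \<in> {1..k}"
    show "(w i has_vector_derivative fact i *\<^sub>R jet_coeff W' i t) (at t)"
      unfolding w_def W'_def
      using has_vector_derivative_scaleR[OF DERIV_const[where k = "fact i"]
          jet_coeff_partial_derivative[where j = i, OF \<Omega> CW \<Omega>_0[of t]]]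
      by simp
    show "continuous_on UNIV (\<lambda>t. fact i *\<^sub>R jet_coeff W' i t)"
      by (intro continuous_intros continuous_on_jet_coeff[OF CW' \<Omega>_0])
    \<comment> \<open>The stroboscopic condition at time 0: all coefficients of positive order start at zero.\<close>
    have "\<forall>\<^sub>F \<epsilon> in at 0. W (0, \<epsilon>) = z"
      using eventually_abs_le_at_0[OF \<epsilon>\<^sub>0]
      by eventually_elim (simp add: W_def U_def X_def y_def averaged_y_0 U_0 z)
    then have "\<forall>\<^sub>F \<epsilon> in at 0. z = W (0, \<epsilon>)" by eventually_elim simp
    from has_jet_unique[OF W_jet has_jet_cong[OF this refl has_jet_const], of i] i
    show "w i 0 = 0" by (simp add: w_def)
    show "fact i *\<^sub>R jet_coeff W' i t = fact i *\<^sub>R (F i t z + (\<Sum>j=1..i - 1. \<Sum>m=1..j. (1 / fact j) *\<^sub>R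
      bell_apply (nth_frechet (F (i - j) t) z) j m (\<lambda>l. w l t)))"
      unfolding W'_jet[OF i] ..
  qed (rule i)
  also have "w i T = y i T"
  proof -
    \<comment> \<open>By periodicity the stroboscopic condition also holds at time \<open>T\<close>.\<close>
    have "\<forall>\<^sub>F \<epsilon> in at 0. X T \<epsilon> = W (T, \<epsilon>)"
      using X_V[of T] eventually_abs_le_at_0[OF \<epsilon>\<^sub>0]
      by eventually_elim (use V(4) in \<open>auto simp: W_def U_def U_T U_0\<close>)
    from has_jet_unique[OF W_jet has_jet_cong[OF this refl X_jet], of i] i
    show ?thesis by (simp add: w_def)
  qed
  finally show ?thesis by (simp add: y_def)
qed

theorem theorem1:
  fixes D :: "(real ^ 'n) set"
    and F :: "nat \<Rightarrow> real \<Rightarrow> real ^ 'n \<Rightarrow> real ^ 'n"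
    and R :: "real \<Rightarrow> real ^ 'n \<Rightarrow> real \<Rightarrow> real ^ 'n"
    and g :: "nat \<Rightarrow> real ^ 'n \<Rightarrow> real ^ 'n"
    and k :: nat and T \<epsilon>\<^sub>0 :: real
  assumes "k \<ge> 1" and "open D" and "T > 0" and "\<epsilon>\<^sub>0 > 0"
    and "\<And>i. i \<in> {1..k} \<Longrightarrow> smooth_on (UNIV \<times> D) (\<lambda>(t, x). F i t x)"
    and "\<And>i t x. i \<in> {1..k} \<Longrightarrow> x \<in> D \<Longrightarrow> F i (t + T) x = F i t x"
    and "smooth_on (UNIV \<times> D \<times> {-\<epsilon>\<^sub>0..\<epsilon>\<^sub>0}) (\<lambda>(t, x, \<epsilon>). R t x \<epsilon>)"
    and "\<And>t x \<epsilon>. x \<in> D \<Longrightarrow> \<epsilon> \<in> {-\<epsilon>\<^sub>0..\<epsilon>\<^sub>0} \<Longrightarrow> R (t + T) x \<epsilon> = R t x \<epsilon>"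
    and "stroboscopic_averaged k D T \<epsilon>\<^sub>0 F R g"
  shows "(\<forall>z\<in>D. g 1 z = (1 / T) *\<^sub>R melnikov F T 1 z) \<and>
    (\<forall>i\<in>{2..k}. \<forall>z\<in>D. g i z = (1 / T) *\<^sub>R (melnikov F T i z -
       (\<Sum>j=1..i - 1. \<Sum>m=1..j. (1 / fact j) *\<^sub>R
          (LBINT s=0..T. bell_apply (nth_frechet (g (i - j)) z) j m
             (\<lambda>l. averaged_y g l s z))))) \<and>
    (\<forall>i\<in>{1..k}. \<exists>N c. \<forall>z\<in>D. \<forall>t. averaged_y g i t z = (\<Sum>l\<le>N. t ^ l *\<^sub>R c l z))"
proof (intro conjI ballI)
  have g: "\<And>i. i \<in> {1..k} \<Longrightarrow> Cinf_on (g i) D"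
    using smooth_on_open_imp_Ck_on[OF assms(2) bspec[OF assms(9)[unfolded stroboscopic_averaged_def, THEN conjunct1]]]
    by blast
  have main: "g i z = (1 / T) *\<^sub>R (melnikov F T i z - (\<Sum>j=1..i - 1. \<Sum>m=1..j. (1 / fact j) *\<^sub>R
      (LBINT s=0..T. bell_apply (nth_frechet (g (i - j)) z) j m (\<lambda>l. averaged_y g l s z))))"
    if "i \<in> {1..k}" "z \<in> D" for i z
  proof -
    let ?I = "\<lambda>j m. LBINT s=0..T. bell_apply (nth_frechet (g (i - j)) z) j m (\<lambda>l. averaged_y g l s z)"
    have "melnikov F T i z = (1 / fact i) *\<^sub>R averaged_y g i T z"
      using melnikov_y_eq_averaged_y[OF assms(2,4,5,7,9) that(2,1)] by (simp add: melnikov_def)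
    also have "\<dots> = T *\<^sub>R g i z + (\<Sum>j=1..i - 1. \<Sum>m=1..j. (1 / fact j) *\<^sub>R ?I j m)"
      by (subst averaged_y.simps) (simp add: scaleR_add_right scaleR_sum_right)
    finally show ?thesis using assms(3) by simp
  qed
  show "g 1 z = (1 / T) *\<^sub>R melnikov F T 1 z" if "z \<in> D" for z
    using main[of 1 z] that assms(1) by simp
  show "g i z = (1 / T) *\<^sub>R (melnikov F T i z - (\<Sum>j=1..i - 1. \<Sum>m=1..j. (1 / fact j) *\<^sub>R
      (LBINT s=0..T. bell_apply (nth_frechet (g (i - j)) z) j m (\<lambda>l. averaged_y g l s z))))"
    if "i \<in> {2..k}" "z \<in> D" for i z
    using main[of i z] that by simp
  show "\<exists>N c. \<forall>z\<in>D. \<forall>t. averaged_y g i t z = (\<Sum>l\<le>N. t ^ l *\<^sub>R c l z)" if "i \<in> {1..k}" for i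
  proof -
    have "\<forall>z\<in>D. \<exists>c. \<forall>t. averaged_y g i t z = (\<Sum>l\<le>i. t ^ l *\<^sub>R c l)"
      using averaged_y_polynomial[where g = g, OF assms(2) g _ that] unfolding poly_degree_le_def by simp
    from bchoice[OF this] obtain c where "\<forall>z\<in>D. \<forall>t. averaged_y g i t z = (\<Sum>l\<le>i. t ^ l *\<^sub>R c z l)"
      by blast
    then show ?thesis by (intro exI[of _ i] exI[of _ "\<lambda>l z. c z l"])
  qed
qed

end
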